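(* Let $K$ be a finite field extension of $\mathbb{F}_q(t)$, let $\phi_1:A\to K\{\tau\},\dots,\phi_g:A\to K\{\tau\}$ be Drinfeld modules, and denote by $\phi$ the coordinate-wise action of $(\phi_1,\dots,\phi_g)$ on $\mathbb{G}_a^g$. Let $V\subset\mathbb{G}_a^g$ be an affine subvariety defined over $K$. Let $\Gamma\subset\mathbb{G}_a^g(K)$ be a finitely generated $\phi$-submodule of rank $1$. Then $V(K)\cap\Gamma$ is a finite union of cosets of $\phi$-submodules of $\Gamma$. In particular, if $V$ is an irreducible curve which is not a translate of an algebraic $\phi$-submodule, then $V(K)\cap\Gamma$ is finite.
   Context: Let $p$ be a prime, $q$ a power of $p$, $A=\mathbb{F}_q[t]$, and $g$ a positive integer. Let $K\{\tau\}$ be the ring of polynomials in $\tau$ with coefficients in $K$, where $\tau$ is the Frobenius $x\mapsto x^q$; addition is the usual one and multiplication is composition. A Drinfeld module is a ring morphism $\phi:A\to K\{\tau\}$, $a\mapsto\phi_a$, such that the coefficient of $\tau^0$ in $\phi_a$ is $a$ for every $a\in A$, and there is some $a\in A$ with $\phi_a\neq a\tau^0$. Given Drinfeld modules $\phi_1,\dots,\phi_g$, the ring $A$ acts on $\mathbb{G}_a^g(\overline K)=\overline K^g$ coordinate-wise by $\phi_a(z_1,\dots,z_g)=((\phi_1)_a(z_1),\dots,(\phi_g)_a(z_g))$. A $\phi$-submodule is a subgroup of $\mathbb{G}_a^g(\overline K)$ invariant under this action. The rank of a $\phi$-submodule $\Gamma$ is $\dim_{\mathbb{F}_q(t)}\Gamma\otimes_A\mathbb{F}_q(t)$.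 An algebraic $\phi$-submodule of $\mathbb{G}_a^g$ is an irreducible algebraic subgroup of $\mathbb{G}_a^g$ invariant under the action of $(\phi_1,\dots,\phi_g)$. All subvarieties are closed. Finite unions may be empty. *)

theory Defs
  imports
    "HOL-Algebra.Algebraic_Closure_Type"
    "HOL-Library.Poly_Mapping"
    "HOL-Library.Extended_Nat"
    "HOL-Analysis.Finite_Cartesian_Product"
    "HOL-Computational_Algebra.Computational_Algebra"
begin

text \<open>
  Throughout, \<open>'q\<close> is the field \<open>F_q\<close> (so \<open>q = CARD('q)\<close>), \<open>'q poly\<close> is \<open>A = F_q[t]\<close>,
  \<open>'q poly fract\<close> is \<open>F_q(t)\<close>, \<open>'k\<close> is \<open>K\<close>, \<open>'k alg_closure\<close> is its algebraic closure, and
  \<open>'k alg_closure ^ 'g\<close> is \<open>G_a^g\<close> (identified with its points over the algebraic closure), with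
  \<open>g = CARD('g)\<close>.
\<close>

section \<open>Finite field extensions\<close>

definition finite_field_extension :: "('f::field \<Rightarrow> 'k::field) \<Rightarrow> bool" where
  "finite_field_extension \<iota> \<longleftrightarrow>
     \<iota> \<in> ring_hom ring_of_type_algebra ring_of_type_algebra \<and>
     (\<exists>B. finite B \<and> module.span (\<lambda>c x. \<iota> c * x) B = UNIV)"

section \<open>The ring \<open>K{\<tau>}\<close> and Drinfeld modules\<close>

text \<open>
  The element \<open>\<Sum> a_i \<tau>^i\<close> of \<open>K{\<tau>}\<close> is encoded as the polynomial \<open>\<Sum> a_i X^(q^i)\<close>. Hence the
  product is literally composition of polynomials, \<open>[:0, 1:]\<close> is the unit \<open>\<tau>^0\<close>, the coefficient
  of \<open>\<tau>^0\<close> is the coefficient of \<open>X^1\<close>, and the value at a point is given by \<^const>\<open>poly\<close>.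
\<close>

definition tau_ring :: "nat \<Rightarrow> 'k::field poly ring" where
  "tau_ring q = \<lparr>
     carrier = {f. \<forall>n. Polynomial.coeff f n \<noteq> 0 \<longrightarrow> (\<exists>i. n = q ^ i)},
     monoid.mult = pcompose,
     one = [:0, 1:],
     ring.zero = 0,
     add = (+) \<rparr>"

definition drinfeld_module ::
  "('q::finite_field poly fract \<Rightarrow> 'k::field) \<Rightarrow> ('q poly \<Rightarrow> 'k poly) \<Rightarrow> bool" where
  "drinfeld_module \<iota> \<phi> \<longleftrightarrow>
     \<phi> \<in> ring_hom ring_of_type_algebra (tau_ring CARD('q)) \<and>
     (\<forall>a. Polynomial.coeff (\<phi> a) 1 = \<iota> (Fract a 1)) \<and>
     (\<exists>a. \<phi> a \<noteq> Polynomial.monom (\<iota> (Fract a 1)) 1)"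

definition phi_action ::
  "('g::finite \<Rightarrow> 'q::finite_field poly \<Rightarrow> 'k::field poly) \<Rightarrow> 'q poly
     \<Rightarrow> 'k alg_closure ^ 'g \<Rightarrow> 'k alg_closure ^ 'g" where
  "phi_action \<phi> a z = (\<chi> i. poly (map_poly to_ac (\<phi> i a)) (z $ i))"

text \<open>
  For Drinfeld modules this action makes \<open>G_a^g\<close> an \<open>A\<close>-module (lemma \<open>module_phi_action\<close> below),
  so the library's submodules apply; they are the subgroups invariant under the action.
\<close>

definition phi_submodule ::
  "('g::finite \<Rightarrow> 'q::finite_field poly \<Rightarrow> 'k::field poly) \<Rightarrow> ('k alg_closure ^ 'g) set \<Rightarrow> bool" where
  "phi_submodule \<phi> S \<longleftrightarrow> module.subspace (phi_action \<phi>) S"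

definition phi_finitely_generated ::
  "('g::finite \<Rightarrow> 'q::finite_field poly \<Rightarrow> 'k::field poly) \<Rightarrow> ('k alg_closure ^ 'g) set \<Rightarrow> bool" where
  "phi_finitely_generated \<phi> S \<longleftrightarrow> (\<exists>F. finite F \<and> S = module.span (phi_action \<phi>) F)"

section \<open>The rank of a module\<close>

text \<open>
  For a submodule \<open>M\<close> of an \<open>R\<close>-module and \<open>F = Frac R\<close>, the \<open>F\<close>-vector space \<open>M \<otimes>\<^sub>R F\<close> is the quotient
  of the free \<open>F\<close>-vector space on the symbols \<open>x \<otimes> 1\<close> for \<open>x \<in> M\<close> by the subspace spanned by
  \<open>(x + y) \<otimes> 1 - x \<otimes> 1 - y \<otimes> 1\<close> and \<open>a x \<otimes> 1 - a (x \<otimes> 1)\<close>. The symbol \<open>x \<otimes> 1\<close> is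
  \<open>Poly_Mapping.single x 1\<close>.
\<close>

definition free_scale :: "'f::field \<Rightarrow> ('v \<Rightarrow>\<^sub>0 'f) \<Rightarrow> ('v \<Rightarrow>\<^sub>0 'f)" where
  "free_scale c = Poly_Mapping.map ((*) c)"

definition tensor_generators :: "'v set \<Rightarrow> ('v \<Rightarrow>\<^sub>0 'r::idom fract) set" where
  "tensor_generators M = {f. Poly_Mapping.keys f \<subseteq> M}"

definition tensor_relations ::
  "('r::idom \<Rightarrow> 'v::ab_group_add \<Rightarrow> 'v) \<Rightarrow> 'v set \<Rightarrow> ('v \<Rightarrow>\<^sub>0 'r fract) set" where
  "tensor_relations scl M = module.span free_scale
     ({Poly_Mapping.single (x + y) 1 - Poly_Mapping.single x 1 - Poly_Mapping.single y 1
         | x y. x \<in> M \<and> y \<in> M} \<union>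
      {Poly_Mapping.single (scl a x) 1 - free_scale (Fract a 1) (Poly_Mapping.single x 1)
         | a x. x \<in> M})"

text \<open>
  The cosets \<open>b + R\<close> for \<open>b \<in> B\<close> are pairwise distinct and form a basis of the quotient space \<open>E / R\<close>.
\<close>

definition quotient_basis ::
  "('f::field \<Rightarrow> 'v::ab_group_add \<Rightarrow> 'v) \<Rightarrow> 'v set \<Rightarrow> 'v set \<Rightarrow> 'v set \<Rightarrow> bool" where
  "quotient_basis scl E R B \<longleftrightarrow>
     B \<subseteq> E \<and>
     (\<forall>T u. finite T \<and> T \<subseteq> B \<and> (\<Sum>b\<in>T. scl (u b) b) \<in> R \<longrightarrow> (\<forall>b\<in>T. u b = 0)) \<and>
     (\<forall>x\<in>E. \<exists>y\<in>module.span scl B. x - y \<in> R)"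

definition has_rank ::
  "('r::idom \<Rightarrow> 'v::ab_group_add \<Rightarrow> 'v) \<Rightarrow> 'v set \<Rightarrow> nat \<Rightarrow> bool" where
  "has_rank scl M n \<longleftrightarrow>
     (\<exists>B. quotient_basis free_scale (tensor_generators M) (tensor_relations scl M) B \<and>
          finite B \<and> card B = n)"

section \<open>Affine varieties\<close>

text \<open>Polynomials in variables indexed by \<open>'g\<close> have type \<open>('g \<Rightarrow>\<^sub>0 nat) \<Rightarrow>\<^sub>0 'l\<close>.\<close>

definition mpoly_eval :: "(('g::finite \<Rightarrow>\<^sub>0 nat) \<Rightarrow>\<^sub>0 'l::field) \<Rightarrow> 'l ^ 'g \<Rightarrow> 'l" where
  "mpoly_eval p z =
     (\<Sum>m\<in>Poly_Mapping.keys p. Poly_Mapping.lookup p m * (\<Prod>i\<in>UNIV. (z $ i) ^ Poly_Mapping.lookup m i))"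

definition zero_locus :: "(('g::finite \<Rightarrow>\<^sub>0 nat) \<Rightarrow>\<^sub>0 'l::field) set \<Rightarrow> ('l ^ 'g) set" where
  "zero_locus P = {z. \<forall>p\<in>P. mpoly_eval p z = 0}"

definition zariski_closed :: "('l::field ^ 'g::finite) set \<Rightarrow> bool" where
  "zariski_closed V \<longleftrightarrow> (\<exists>P. V = zero_locus P)"

text \<open>
  A subvariety defined over \<open>K\<close> is a zero set in the affine space over the algebraic closure of
  polynomials with coefficients in \<open>K\<close>; it need not be irreducible. Irreducibility and dimension
  below refer to the Zariski topology over the algebraic closure.
\<close>

definition subvariety_over_base :: "('k::field alg_closure ^ 'g::finite) set \<Rightarrow> bool" where
  "subvariety_over_base V \<longleftrightarrow>
     (\<exists>P :: (('g \<Rightarrow>\<^sub>0 nat) \<Rightarrow>\<^sub>0 'k) set. V = zero_locus (Poly_Mapping.map to_ac ` P))"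

definition rational_points :: "('k::field alg_closure ^ 'g::finite) set" where
  "rational_points = {z. \<forall>i. z $ i \<in> range to_ac}"

definition irreducible_closed :: "('l::field ^ 'g::finite) set \<Rightarrow> bool" where
  "irreducible_closed V \<longleftrightarrow>
     zariski_closed V \<and> V \<noteq> {} \<and>
     (\<forall>V1 V2. zariski_closed V1 \<and> zariski_closed V2 \<and> V = V1 \<union> V2 \<longrightarrow> V = V1 \<or> V = V2)"

text \<open>Krull dimension (with value \<open>0\<close> instead of \<open>-\<infinity>\<close> on the empty set).\<close>

definition zariski_dim :: "('l::field ^ 'g::finite) set \<Rightarrow> enat" where
  "zariski_dim V = Sup {enat n | n. \<exists>Z :: nat \<Rightarrow> ('l ^ 'g) set.
     (\<forall>i\<le>n. irreducible_closed (Z i) \<and> Z i \<subseteq> V) \<and> (\<forall>i<n. Z i \<subset> Z (Suc i))}"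

definition irreducible_curve :: "('l::field ^ 'g::finite) set \<Rightarrow> bool" where
  "irreducible_curve V \<longleftrightarrow> irreducible_closed V \<and> zariski_dim V = 1"

definition algebraic_phi_submodule ::
  "('g::finite \<Rightarrow> 'q::finite_field poly \<Rightarrow> 'k::field poly) \<Rightarrow> ('k alg_closure ^ 'g) set \<Rightarrow> bool" where
  "algebraic_phi_submodule \<phi> H \<longleftrightarrow> irreducible_closed H \<and> phi_submodule \<phi> H"

section \<open>Well-definedness of the structures\<close>

lemma coeff_1_plus_X_power:
  "Polynomial.coeff ([:1, 1:] ^ n :: 'a::comm_ring_1 poly) k = of_nat (n choose k)"
proof -
  have "[:1, 1:] ^ n = (Polynomial.monom 1 1 + 1 :: 'a poly) ^ n"
    by (simp add: monom_altdef one_pCons)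
  also have "\<dots> = (\<Sum>j\<le>n. Polynomial.monom (of_nat (n choose j)) j)"
    by (simp add: binomial_ring monom_power of_nat_poly smult_monom mult.commute)
  finally show ?thesis
    by (simp add: coeff_sum sum.delta binomial_eq_0)
qed

lemma of_nat_CARD_choose_eq_0:
  assumes "0 < k" "k < CARD('q)"
  shows "of_nat (CARD('q) choose k) = (0 :: 'q::finite_field)"
proof -
  define p where "p = ([:1, 1:] ^ CARD('q) - 1 - Polynomial.monom 1 CARD('q) :: 'q poly)"
  have cf: "Polynomial.coeff p j =
      (if j = 0 then 1 - 1 else if j < CARD('q) then of_nat (CARD('q) choose j) else 0)" for j
    using finite_UNIV_card_ge_0[where ?'a = 'q]
    by (auto simp: p_def coeff_1_plus_X_power binomial_eq_0)
  have "poly p x = 0" for x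
    using finite_field_power_card_eq_same[of x] finite_field_power_card_eq_same[of "1 + x"]
    by (simp add: p_def poly_monom)
  moreover have "Polynomial.degree p < CARD('q)"
    using finite_UNIV_card_ge_0[where ?'a = 'q]
    by (intro degree_lessI) (auto simp: cf)
  ultimately have "p = 0"
    using card_poly_roots_bound[of p] by fastforce
  with cf[of k] assms show ?thesis by simp
qed

lemma frobenius_add:
  fixes x y :: "'a::comm_ring_1"
  assumes char: "\<And>n. of_nat n = (0 :: 'q::finite_field) \<Longrightarrow> of_nat n = (0 :: 'a)"
  shows "(x + y) ^ (CARD('q) ^ i) = x ^ (CARD('q) ^ i) + y ^ (CARD('q) ^ i)"
proof (induction i)
  case (Suc i)
  have *: "(u + v) ^ CARD('q) = u ^ CARD('q) + v ^ CARD('q)" for u v :: 'a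
  proof -
    have q: "0 < CARD('q)" by simp
    have "(u + v) ^ CARD('q) =
        (\<Sum>k\<le>CARD('q). of_nat (CARD('q) choose k) * u ^ k * v ^ (CARD('q) - k))"
      by (rule binomial_ring)
    also have "\<dots> = (\<Sum>k\<in>{0, CARD('q)}. of_nat (CARD('q) choose k) * u ^ k * v ^ (CARD('q) - k))"
      using char[OF of_nat_CARD_choose_eq_0[where ?'q = 'q]]
      by (intro sum.mono_neutral_right) (auto simp: le_less)
    also have "\<dots> = u ^ CARD('q) + v ^ CARD('q)"
      using q by simp
    finally show ?thesis .
  qed
  show ?case
    using * Suc by (simp add: power_mult mult.commute[of "CARD('q)"])
qed simp

lemma frobenius_sum:
  fixes f :: "'b \<Rightarrow> 'a::comm_ring_1"
  assumes char: "\<And>n. of_nat n = (0 :: 'q::finite_field) \<Longrightarrow> of_nat n = (0 :: 'a)"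
  shows "sum f S ^ (CARD('q) ^ i) = (\<Sum>x\<in>S. f x ^ (CARD('q) ^ i))"
proof (induction S rule: infinite_finite_induct)
  case (insert x S)
  then show ?case
    using frobenius_add[where ?'q = 'q, OF char, of "f x" "sum f S" i] by simp
qed (simp_all add: power_0_left)

lemma pcompose_conv_sum:
  "pcompose f g = (\<Sum>n\<le>Polynomial.degree f. Polynomial.smult (Polynomial.coeff f n) (g ^ n))"
  by (simp add: pcompose_altdef poly_altdef degree_map_poly coeff_map_poly)

context
  assumes char: "\<And>n. of_nat n = (0 :: 'q::finite_field) \<Longrightarrow> of_nat n = (0 :: 'k::field)"
begin

lemma char_poly: "of_nat n = (0 :: 'q) \<Longrightarrow> of_nat n = (0 :: 'k poly)"
  using char[of n] by (simp add: of_nat_poly)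

lemma tau_ring_pcompose_add:
  fixes f g h :: "'k poly"
  assumes "f \<in> carrier (tau_ring CARD('q))"
  shows "pcompose f (g + h) = pcompose f g + pcompose f h"
  unfolding pcompose_conv_sum sum.distrib[symmetric]
proof (rule sum.cong)
  fix n
  show "Polynomial.smult (Polynomial.coeff f n) ((g + h) ^ n) =
      Polynomial.smult (Polynomial.coeff f n) (g ^ n) + Polynomial.smult (Polynomial.coeff f n) (h ^ n)"
    using assms frobenius_add[where ?'q = 'q, OF char_poly, of g h]
    by (cases "Polynomial.coeff f n = 0") (auto simp: tau_ring_def smult_add_right)
qed simp

lemma tau_ring_pcompose_closed:
  fixes f g :: "'k poly"
  assumes f: "f \<in> carrier (tau_ring CARD('q))" and g: "g \<in> carrier (tau_ring CARD('q))"
  shows "pcompose f g \<in> carrier (tau_ring CARD('q))"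
proof -
  have pow: "\<exists>i. n = CARD('q) ^ i" if "Polynomial.coeff (g ^ (CARD('q) ^ j)) n \<noteq> 0" for n j
  proof -
    have "g ^ (CARD('q) ^ j) = (\<Sum>m\<le>Polynomial.degree g.
        Polynomial.monom (Polynomial.coeff g m ^ (CARD('q) ^ j)) (m * CARD('q) ^ j))"
      by (subst poly_as_sum_of_monoms[of g, symmetric])
         (simp add: frobenius_sum[OF char_poly] monom_power)
    with that obtain m where m: "Polynomial.coeff g m \<noteq> 0" "n = m * CARD('q) ^ j"
      by (auto simp: coeff_sum power_0_left elim!: sum.not_neutral_contains_not_neutral
               split: if_splits)
    from m(1) g obtain i where "m = CARD('q) ^ i"
      by (auto simp: tau_ring_def)
    with m(2) show ?thesis by (metis power_add)
  qed
  show ?thesis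
  proof (simp add: tau_ring_def, intro allI impI)
    fix n assume "Polynomial.coeff (pcompose f g) n \<noteq> 0"
    then obtain m where "Polynomial.coeff f m \<noteq> 0" "Polynomial.coeff (g ^ m) n \<noteq> 0"
      unfolding pcompose_conv_sum coeff_sum
      by (auto elim!: sum.not_neutral_contains_not_neutral)
    with f pow show "\<exists>i. n = CARD('q) ^ i"
      by (auto simp: tau_ring_def)
  qed
qed

lemma ring_tau_ring: "ring (tau_ring CARD('q) :: 'k poly ring)"
proof (rule ringI)
  show "abelian_group (tau_ring CARD('q) :: 'k poly ring)"
  proof (rule abelian_groupI)
    fix x y :: "'k poly"
    assume "x \<in> carrier (tau_ring CARD('q))" "y \<in> carrier (tau_ring CARD('q))"
    moreover have "Polynomial.coeff x n \<noteq> 0 \<or> Polynomial.coeff y n \<noteq> 0"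
      if "Polynomial.coeff (x + y) n \<noteq> 0" for n
      using that by auto
    ultimately show "x \<oplus>\<^bsub>tau_ring CARD('q)\<^esub> y \<in> carrier (tau_ring CARD('q))"
      unfolding tau_ring_def partial_object.simps ring_record_simps mem_Collect_eq by blast
  next
    fix x :: "'k poly" assume "x \<in> carrier (tau_ring CARD('q))"
    then show "\<exists>y\<in>carrier (tau_ring CARD('q)). y \<oplus>\<^bsub>tau_ring CARD('q)\<^esub> x = \<zero>\<^bsub>tau_ring CARD('q)\<^esub>"
      by (intro bexI[of _ "-x"]) (auto simp: tau_ring_def)
  qed (auto simp: tau_ring_def algebra_simps)
  show "monoid (tau_ring CARD('q) :: 'k poly ring)"
  proof (rule monoidI)
    show "\<one>\<^bsub>tau_ring CARD('q)\<^esub> \<in> carrier (tau_ring CARD('q) :: 'k poly ring)"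
      by (auto simp: tau_ring_def coeff_pCons split: nat.splits intro!: exI[of _ 0])
    fix x y :: "'k poly"
    assume "x \<in> carrier (tau_ring CARD('q))" "y \<in> carrier (tau_ring CARD('q))"
    then show "x \<otimes>\<^bsub>tau_ring CARD('q)\<^esub> y \<in> carrier (tau_ring CARD('q))"
      using tau_ring_pcompose_closed[of x y] by (simp add: tau_ring_def)
  qed (simp_all add: tau_ring_def pcompose_assoc pcompose_pCons)
  fix x y z :: "'k poly"
  assume z: "z \<in> carrier (tau_ring CARD('q))"
  show "(x \<oplus>\<^bsub>tau_ring CARD('q)\<^esub> y) \<otimes>\<^bsub>tau_ring CARD('q)\<^esub> z =
      x \<otimes>\<^bsub>tau_ring CARD('q)\<^esub> z \<oplus>\<^bsub>tau_ring CARD('q)\<^esub> y \<otimes>\<^bsub>tau_ring CARD('q)\<^esub> z"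
    by (simp add: tau_ring_def pcompose_add)
  show "z \<otimes>\<^bsub>tau_ring CARD('q)\<^esub> (x \<oplus>\<^bsub>tau_ring CARD('q)\<^esub> y) =
      z \<otimes>\<^bsub>tau_ring CARD('q)\<^esub> x \<oplus>\<^bsub>tau_ring CARD('q)\<^esub> z \<otimes>\<^bsub>tau_ring CARD('q)\<^esub> y"
    using tau_ring_pcompose_add[OF z, of x y] by (simp add: tau_ring_def)
qed

end

lemma finite_field_extension_char:
  fixes \<iota> :: "'q::finite_field poly fract \<Rightarrow> 'k::field"
  assumes "finite_field_extension \<iota>" "of_nat n = (0 :: 'q)"
  shows "of_nat n = (0 :: 'k)"
proof -
  have hom: "\<iota> (x + y) = \<iota> x + \<iota> y" "\<iota> 1 = 1" for x y
    using assms(1) by (auto simp: finite_field_extension_def ring_hom_def ring_of_type_algebra_def)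
  have "\<iota> (0 + 0) = \<iota> 0 + \<iota> 0"
    by (rule hom)
  then have "\<iota> 0 = 0"
    unfolding add_0_right by (rule add_cancel_right_right[THEN iffD1])
  then have "\<iota> (of_nat m) = of_nat m" for m
    by (induction m) (simp_all add: hom)
  moreover have "of_nat n = (0 :: 'q poly fract)"
    using assms(2) by (simp add: of_nat_fract of_nat_poly Zero_fract_def)
  ultimately show ?thesis
    using \<open>\<iota> 0 = 0\<close> by metis
qed

lemma map_poly_to_ac_add:
  "map_poly to_ac (f + g) = map_poly to_ac f + map_poly to_ac g"
  by (rule poly_eqI) (simp add: coeff_map_poly)

lemma map_poly_to_ac_pcompose:
  fixes f g :: "'k::field poly"
  shows "map_poly to_ac (pcompose f g) = pcompose (map_poly to_ac f) (map_poly to_ac g)"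
proof -
  have mult: "map_poly to_ac (f * g) = map_poly to_ac f * map_poly to_ac g" for f g :: "'k poly"
    by (rule poly_eqI) (simp add: coeff_map_poly coeff_mult to_ac_sum)
  show ?thesis
    by (induction f)
       (simp_all add: pcompose_pCons map_poly_to_ac_add mult map_poly_pCons)
qed

lemma tau_ring_eval_add:
  fixes x y :: "'k::field alg_closure"
  assumes char: "\<And>n. of_nat n = (0 :: 'q::finite_field) \<Longrightarrow> of_nat n = (0 :: 'k)"
    and f: "f \<in> carrier (tau_ring CARD('q))"
  shows "poly (map_poly to_ac f) (x + y) = poly (map_poly to_ac f) x + poly (map_poly to_ac f) y"
  unfolding poly_altdef sum.distrib[symmetric]
proof (rule sum.cong)
  fix n
  have "of_nat m = (0 :: 'k alg_closure)" if "of_nat m = (0 :: 'q)" for m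
    using char[OF that] by (metis to_ac_0 to_ac_of_nat)
  from frobenius_add[where ?'q = 'q, OF this, of x y] f
  show "Polynomial.coeff (map_poly to_ac f) n * (x + y) ^ n =
      Polynomial.coeff (map_poly to_ac f) n * x ^ n + Polynomial.coeff (map_poly to_ac f) n * y ^ n"
    by (cases "Polynomial.coeff f n = 0") (auto simp: tau_ring_def coeff_map_poly algebra_simps)
qed simp

lemma module_phi_action:
  fixes \<phi> :: "'g::finite \<Rightarrow> 'q::finite_field poly \<Rightarrow> 'k::field poly"
  assumes "finite_field_extension \<iota>" and \<phi>: "\<And>i. drinfeld_module \<iota> (\<phi> i)"
  shows "Modules.module (phi_action \<phi>)"
proof
  have hom: "\<phi> i a \<in> carrier (tau_ring CARD('q))" "\<phi> i (a + b) = \<phi> i a + \<phi> i b"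
      "\<phi> i (a * b) = pcompose (\<phi> i a) (\<phi> i b)" "\<phi> i 1 = [:0, 1:]" for i a b
    using \<phi>[of i] by (auto simp: drinfeld_module_def ring_hom_def ring_of_type_algebra_def tau_ring_def)
  fix a b x y
  show "phi_action \<phi> a (x + y) = phi_action \<phi> a x + phi_action \<phi> a y"
    using tau_ring_eval_add[OF finite_field_extension_char[OF assms(1)] hom(1)]
    by (simp add: phi_action_def vec_eq_iff)
  show "phi_action \<phi> (a + b) x = phi_action \<phi> a x + phi_action \<phi> b x"
    by (simp add: phi_action_def vec_eq_iff hom map_poly_to_ac_add)
  show "phi_action \<phi> a (phi_action \<phi> b x) = phi_action \<phi> (a * b) x"
    by (simp add: phi_action_def vec_eq_iff hom map_poly_to_ac_pcompose poly_pcompose)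
  show "phi_action \<phi> 1 x = x"
    by (simp add: phi_action_def vec_eq_iff hom map_poly_pCons)
qed

lemma vector_space_free_scale: "vector_space (free_scale :: 'f::field \<Rightarrow> ('v \<Rightarrow>\<^sub>0 'f) \<Rightarrow> _)"
proof -
  have *: "Poly_Mapping.lookup (free_scale c f) x = c * Poly_Mapping.lookup f x"
    for c :: 'f and f :: "'v \<Rightarrow>\<^sub>0 'f" and x
    by (simp add: free_scale_def Poly_Mapping.map.rep_eq when_def)
  show ?thesis
    by standard (auto intro!: poly_mapping_eqI simp: * lookup_add algebra_simps)
qed

end

theory Submission
  imports Defs
begin

text \<open>
  The proof is a Skolem--Mahler--Lech argument carried out in \<open>K\<close> itself, without completing at a
  place and without the Drinfeld exponential and logarithm.

  Since \<open>\<Gamma>\<close> is finitely generated of rank \<open>1\<close>, for a suitable \<open>\<gamma> \<in> \<Gamma>\<close> and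
  every multiple \<open>\<delta> = \<phi>\<^sub>b(\<gamma>)\<close> with \<open>b \<noteq> 0\<close> it is a finite union of cosets \<open>x + A \<delta>\<close>
  (\<open>rank_1_generator_up_to_torsion\<close>, \<open>finite_index_of_cyclic_submodule\<close>). It is therefore enough to
  find such a \<open>\<delta>\<close> for which every orbit \<open>a \<mapsto> x + \<phi>\<^sub>a(\<delta>)\<close> with \<open>x \<in> K\<^sup>g\<close> is \<^emph>\<open>rigid\<close>: a closed set that
  contains it for infinitely many \<open>a\<close> contains all of it. Then \<open>V\<close> meets each coset in finitely many
  points or contains it, which is the first claim.

  For a suitable prime \<open>P\<close> of \<open>A\<close> there is a subring \<open>R\<close> of \<open>K\<close>, free of finite rank over the
  local ring of \<open>A\<close> at \<open>P\<close>, which contains finitely many prescribed elements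
  (\<open>exists_adic_ring\<close>); take it to contain \<open>\<gamma>\<close> and the coefficients of \<open>\<phi>\<close>. As \<open>R / P\<^sup>2 R\<close> is
  finite, some nonzero multiple \<open>\<delta>\<close> of \<open>\<gamma>\<close> has coordinates in \<open>P\<^sup>2 R\<close>.

  Write \<open>\<phi>\<^sub>c = \<Sum> D\<^sub>n(c) \<tau>\<^sup>n\<close>. Comparing coefficients in \<open>\<phi>\<^sub>t \<phi>\<^sub>c = \<phi>\<^sub>c \<phi>\<^sub>t\<close> expresses
  \<open>(t^(q^n) - t) D\<^sub>n(c)\<close> through \<open>D\<^sub>j(c)\<close> with \<open>j < n\<close>, and \<open>P\<close> divides \<open>t^(q^n) - t\<close> at most once.
  So \<open>D\<^sub>n\<close> is a polynomial function of \<open>c\<close> whose denominators are beaten by \<open>\<delta>^(q^n)\<close>, and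
  \<open>c \<mapsto> \<phi>\<^sub>c(\<delta>)\<close> is \<^emph>\<open>analytic\<close>: modulo each power of \<open>P\<close> it is a polynomial in \<open>P c\<close> over \<open>R\<close>
  (\<open>analytic_phi\<close>). The extra factor \<open>P\<close> in \<open>P c\<close> yields the identity theorem
  (\<open>analytic_identity\<close>): after dividing out \<open>N\<close> zeros \<open>a\<^sub>1, \<dots>, a\<^sub>N\<close>, each value is divisible by
  \<open>\<Prod> P (c - a\<^sub>i)\<close>, hence by \<open>P\<^sup>N\<close>, so that infinitely many zeros force the function to vanish.
  Composing with polynomials gives rigidity; polynomials over the algebraic closure are reduced to
  \<open>K\<close> by means of \<open>K\<close>-linear functionals (\<open>rigid_orbit\<close>).

  For the second claim, rigidity makes the Zariski closure of \<open>x + A \<delta>\<close> irreducible. If an irreducible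
  curve \<open>V\<close> meets \<open>\<Gamma>\<close> in an infinite set, it contains such a coset that is infinite, so it is its
  closure, which is the translate by \<open>x\<close> of the closure of \<open>A \<delta>\<close>, an algebraic \<open>\<phi>\<close>-submodule.
\<close>

section \<open>The local ring at a prime of \<open>A\<close>\<close>

definition localization :: "'a::idom \<Rightarrow> 'a fract set" where
  "localization P = {Fract a s | a s. \<not> P dvd s}"

lemma Fract_in_localization: "\<not> P dvd s \<Longrightarrow> Fract a s \<in> localization P"
  unfolding localization_def by blast

lemma localizationE:
  assumes "x \<in> localization P"
  obtains a s where "x = Fract a s" "\<not> P dvd s" "s \<noteq> 0"
  using assms unfolding localization_def by auto

context
  fixes P :: "'a::idom"
  assumes P: "prime_elem P"
begin

lemma not_dvd_mult: "\<not> P dvd s \<Longrightarrow> \<not> P dvd s' \<Longrightarrow> \<not> P dvd s * s'"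
  using P by (simp add: prime_elem_dvd_mult_iff)

lemma localization_integer: "Fract a 1 \<in> localization P"
  using P by (intro Fract_in_localization) (auto simp: prime_elem_def)

lemma localization_add: "x \<in> localization P \<Longrightarrow> y \<in> localization P \<Longrightarrow> x + y \<in> localization P"
  by (elim localizationE) (simp add: Fract_in_localization not_dvd_mult)

lemma localization_mult: "x \<in> localization P \<Longrightarrow> y \<in> localization P \<Longrightarrow> x * y \<in> localization P"
  by (elim localizationE) (simp add: Fract_in_localization not_dvd_mult)

lemma localization_uminus: "x \<in> localization P \<Longrightarrow> - x \<in> localization P"
  by (elim localizationE) (auto intro!: Fract_in_localization)

lemma localization_sum:
  "(\<And>i. i \<in> I \<Longrightarrow> f i \<in> localization P) \<Longrightarrow> (\<Sum>i\<in>I. f i) \<in> localization P"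
proof (induction I rule: infinite_finite_induct)
  case (insert x F)
  then show ?case by (simp add: localization_add)
qed (use localization_integer[of 0] in \<open>auto simp: Zero_fract_def\<close>)

lemma power_dvd_cancel: "P ^ n dvd a * s \<Longrightarrow> \<not> P dvd s \<Longrightarrow> P ^ n dvd a"
proof (induction n arbitrary: a)
  case (Suc n)
  from Suc.prems(1) have "P dvd a * s" by (metis dvd_trans dvd_triv_left power_Suc)
  then obtain a' where a': "a = P * a'"
    using P Suc.prems(2) by (auto simp: prime_elem_dvd_mult_iff elim: dvdE)
  have "P ^ n dvd a' * s"
    using Suc.prems(1) P unfolding a' by (auto simp: mult.assoc prime_elem_def)
  from Suc.IH[OF this Suc.prems(2)] show ?case
    unfolding a' by (simp add: mult_dvd_mono)
qed auto

end

lemma Fract_power: "Fract a 1 ^ n = Fract (a ^ n) (1 :: 'a::idom)"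
  by (induction n) (simp_all add: One_fract_def)

context
  fixes P :: "'a::field poly"
  assumes P: "prime_elem P"
begin

lemma prime_degree_pos: "0 < Polynomial.degree P"
proof (rule ccontr)
  assume "\<not> ?thesis"
  then obtain c where "P = [:c:]" by (auto elim: degree_eq_zeroE)
  with P show False by (auto simp: prime_elem_def is_unit_const_poly_iff dvd_field_iff)
qed

lemma prime_power_decompose:
  "a \<noteq> 0 \<Longrightarrow> \<exists>e a'. a = P ^ e * a' \<and> \<not> P dvd a'"
proof (induction "Polynomial.degree a" arbitrary: a rule: less_induct)
  case less
  show ?case
  proof (cases "P dvd a")
    case False
    then show ?thesis by (intro exI[of _ 0] exI[of _ a]) simp
  next
    case True
    then obtain a1 where a1: "a = P * a1" by (elim dvdE)
    with less.prems have "a1 \<noteq> 0" "P \<noteq> 0" by auto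
    then have "Polynomial.degree a1 < Polynomial.degree a"
      using prime_degree_pos by (simp add: a1 degree_mult_eq)
    from less.hyps[OF this \<open>a1 \<noteq> 0\<close>] obtain e a' where "a1 = P ^ e * a'" "\<not> P dvd a'" by blast
    then show ?thesis by (intro exI[of _ "Suc e"] exI[of _ a']) (simp add: a1 mult.assoc)
  qed
qed

lemma localization_clear_denominator: "\<exists>k. Fract P 1 ^ k * x \<in> localization P"
proof (cases x)
  case (Fract a b)
  obtain e b' where b': "b = P ^ e * b'" "\<not> P dvd b'"
    using prime_power_decompose[of b] Fract by auto
  have "b' \<noteq> 0" using b'(2) by auto
  then have "Fract P 1 ^ e * x = Fract a b'"
    using P b' by (auto simp: Fract Fract_power eq_fract prime_elem_def algebra_simps)
  then show ?thesis using b'(2) by (metis Fract_in_localization)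
qed

text \<open>
  If \<open>P^n\<close> divides \<open>a / b\<close> in the local ring, it divides the numerator \<open>a\<close>, because the denominators
  allowed there are prime to \<open>P\<close>. For large \<open>n\<close> the degree leaves only \<open>a = 0\<close>.
\<close>

lemma localization_separated:
  assumes "\<And>n. \<exists>y\<in>localization P. x = Fract P 1 ^ n * y"
  shows "x = 0"
proof (cases x)
  case (Fract a b)
  have dvd: "P ^ n dvd a" for n
  proof -
    obtain y where y: "y \<in> localization P" "x = Fract P 1 ^ n * y" using assms by blast
    from y(1) obtain c s where cs: "y = Fract c s" "\<not> P dvd s" "s \<noteq> 0" by (rule localizationE)
    have "a * s = P ^ n * (c * b)"
      using y(2) cs Fract by (simp add: Fract_power eq_fract mult_ac)
    then show ?thesis
      using power_dvd_cancel[OF P, of n a s] cs(2) by auto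
  qed
  have "a = 0"
  proof (rule ccontr)
    assume "a \<noteq> 0"
    let ?n = "Suc (Polynomial.degree a)"
    have "Polynomial.degree (P ^ ?n) = ?n * Polynomial.degree P"
      using P by (subst degree_power_eq) (auto simp: prime_elem_def)
    moreover have "Polynomial.degree (P ^ ?n) \<le> Polynomial.degree a"
      using dvd \<open>a \<noteq> 0\<close> by (rule dvd_imp_degree_le)
    moreover have "?n * 1 \<le> ?n * Polynomial.degree P"
      using prime_degree_pos by (intro mult_le_mono2) auto
    ultimately have "?n \<le> Polynomial.degree a" by (metis le_trans mult.right_neutral)
    then show False by simp
  qed
  then show ?thesis by (simp add: Fract Zero_fract_def eq_fract)
qed

end

lemma finite_poly_degree_less: "finite {p :: 'a::{finite,zero} poly. Polynomial.degree p < n}"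
proof (rule finite_subset)
  show "{p :: 'a poly. Polynomial.degree p < n} \<subseteq> Poly ` {xs. set xs \<subseteq> UNIV \<and> length xs \<le> n}"
  proof
    fix p :: "'a poly" assume "p \<in> {p. Polynomial.degree p < n}"
    then have "length (coeffs p) \<le> n" by (auto simp: length_coeffs_degree Polynomial.coeffs_def)
    then show "p \<in> Poly ` {xs. set xs \<subseteq> UNIV \<and> length xs \<le> n}"
      by (intro image_eqI[of _ _ "coeffs p"]) auto
  qed
  show "finite (Poly ` {xs :: 'a list. set xs \<subseteq> UNIV \<and> length xs \<le> n})"
    by (intro finite_imageI finite_lists_length_le) auto
qed

text \<open>
  Every residue class modulo \<open>P\<^sup>2\<close> of the local ring is represented by one of the finitely many
  polynomials of degree below \<open>deg P\<^sup>2\<close>: multiplication by the denominator \<open>s\<close> is injective on these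
  remainders, hence bijective, so \<open>a \<equiv> r s\<close> can be solved for \<open>r\<close>.
\<close>

lemma localization_residues:
  fixes P :: "'a::{field,finite} poly"
  assumes P: "prime_elem P" and x: "x \<in> localization P"
  shows "\<exists>r. Polynomial.degree r < Polynomial.degree (P ^ 2) \<and>
    (\<exists>y\<in>localization P. x - Fract r 1 = Fract P 1 ^ 2 * y)"
proof -
  let ?D = "Polynomial.degree (P ^ 2)"
  let ?T = "{r :: 'a poly. Polynomial.degree r < ?D}"
  have P0: "P \<noteq> 0" using P by (simp add: prime_elem_def)
  have D: "0 < ?D" using prime_degree_pos[OF P] P0 by (simp add: degree_power_eq)
  from x obtain a s where as: "x = Fract a s" "\<not> P dvd s" "s \<noteq> 0" by (rule localizationE)
  have mod: "b mod P ^ 2 \<in> ?T" for b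
    using D P0 degree_mod_less[of "P ^ 2" b] by auto
  then have maps: "(\<lambda>r. (r * s) mod P ^ 2) ` ?T \<subseteq> ?T"
    by blast
  have "inj_on (\<lambda>r. (r * s) mod P ^ 2) ?T"
  proof (rule inj_onI)
    fix r r' assume r: "r \<in> ?T" "r' \<in> ?T" and eq: "(r * s) mod P ^ 2 = (r' * s) mod P ^ 2"
    have "P ^ 2 dvd (r - r') * s"
      using eq by (simp add: mod_eq_dvd_iff left_diff_distrib)
    then have "P ^ 2 dvd r - r'" using as(2) power_dvd_cancel[OF P] by blast
    moreover have "Polynomial.degree (r - r') < ?D"
      using r by (auto intro: degree_diff_less)
    ultimately have "r - r' = 0" using dvd_imp_degree_le leD by blast
    then show "r = r'" by simp
  qed
  then have "(\<lambda>r. (r * s) mod P ^ 2) ` ?T = ?T"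
    using maps finite_poly_degree_less by (intro endo_inj_surj)
  with mod[of a] obtain r where r: "r \<in> ?T" "a mod P ^ 2 = (r * s) mod P ^ 2"
    by (metis (no_types, lifting) imageE)
  from r(2) have "P ^ 2 dvd a - r * s" by (simp add: mod_eq_dvd_iff)
  then obtain c where c: "a - r * s = P ^ 2 * c" by (elim dvdE)
  have "x - Fract r 1 = Fract P 1 ^ 2 * Fract c s"
    using as(3) c by (simp add: as(1) Fract_power)
  then show ?thesis using r(1) Fract_in_localization[OF as(2)] by blast
qed

lemma exists_prime_divisor:
  fixes a :: "'a::field poly"
  assumes "0 < Polynomial.degree a"
  shows "\<exists>P. prime_elem P \<and> P dvd a"
  using assms
proof (induction "Polynomial.degree a" arbitrary: a rule: less_induct)
  case less
  show ?case
  proof (cases "irreducible a")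
    case True
    then show ?thesis by (intro exI[of _ a]) (simp add: field_poly_irreducible_imp_prime)
  next
    case False
    have "a \<noteq> 0" using less.prems by auto
    moreover from this have "\<not> a dvd 1" using less.prems by (simp add: is_unit_iff_degree)
    ultimately obtain b c where bc: "a = b * c" "\<not> b dvd 1" "\<not> c dvd 1"
      using False unfolding irreducible_def by blast
    with \<open>a \<noteq> 0\<close> have "b \<noteq> 0" "c \<noteq> 0" by auto
    with bc have "0 < Polynomial.degree b" "0 < Polynomial.degree c" by (auto simp: is_unit_iff_degree)
    moreover from this have "Polynomial.degree b < Polynomial.degree a"
      using bc \<open>b \<noteq> 0\<close> \<open>c \<noteq> 0\<close> by (simp add: degree_mult_eq)
    ultimately show ?thesis using less.hyps[of b] bc(1) dvd_mult2 by blast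
  qed
qed

text \<open>
  Any prime divisor of \<open>h t + 1\<close> does the job, where \<open>h\<close> is a common denominator of \<open>D\<close>.
\<close>

lemma exists_localization_containing:
  fixes D :: "'a::field poly fract set"
  assumes "finite D"
  shows "\<exists>P. prime_elem P \<and> D \<subseteq> localization P"
proof -
  have "\<exists>h. h \<noteq> 0 \<and> (\<forall>P. \<not> P dvd h \<longrightarrow> D \<subseteq> localization P)"
    using assms
  proof (induction D)
    case (insert x D)
    then obtain h where h: "h \<noteq> 0" "\<forall>P. \<not> P dvd h \<longrightarrow> D \<subseteq> localization P" by blast
    obtain a b where "x = Fract a b" "b \<noteq> 0" by (cases x)
    moreover have "insert (Fract a b) D \<subseteq> localization P" if "\<not> P dvd b * h" for P
    proof -
      from that have "\<not> P dvd b" "\<not> P dvd h" by auto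
      then show ?thesis using h(2) Fract_in_localization by blast
    qed
    ultimately show ?case
      using h(1) by (intro exI[of _ "b * h"]) simp
  qed (auto intro: exI[of _ 1])
  then obtain h where h: "h \<noteq> 0" "\<And>P. \<not> P dvd h \<Longrightarrow> D \<subseteq> localization P" by blast
  have "Polynomial.degree (pCons 1 h) > 0" using h(1) by simp
  then obtain P where P: "prime_elem P" "P dvd pCons 1 h" using exists_prime_divisor by blast
  have "\<not> P dvd h"
  proof
    assume "P dvd h"
    then obtain k where "h = P * k" by (elim dvdE)
    then have "pCons 0 h = P * pCons 0 k" by simp
    then have "P dvd pCons 0 h" by (rule dvdI)
    then have "P dvd pCons 1 h - pCons 0 h" using P(2) by (rule dvd_diff[rotated])
    then have "P dvd 1" by (simp add: one_pCons)
    with P(1) show False by (simp add: prime_elem_def)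
  qed
  with h P(1) show ?thesis by blast
qed

lemma CARD_ge_2: "2 \<le> CARD('q::finite_field)"
proof -
  have "card {0, 1 :: 'q} \<le> CARD('q)" by (rule card_mono) auto
  then show ?thesis by simp
qed

text \<open>
  The derivative of \<open>t^(q^n) - t\<close> is \<open>-1\<close>, which has no prime divisor.
\<close>

lemma frobenius_minus_id_squarefree:
  fixes P :: "'q::finite_field poly"
  assumes P: "prime_elem P" and n: "n > 0"
  shows "\<not> P ^ 2 dvd Polynomial.monom 1 (CARD('q) ^ n) - Polynomial.monom 1 1"
proof
  let ?f = "Polynomial.monom 1 (CARD('q) ^ n) - Polynomial.monom 1 1 :: 'q poly"
  assume "P ^ 2 dvd ?f"
  then obtain g where g: "?f = P ^ 2 * g" by (elim dvdE)
  have "of_nat CARD('q) = (0 :: 'q)"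
  proof -
    have "1 < CARD('q)" using CARD_ge_2[where 'q = 'q] by simp
    then show ?thesis using of_nat_CARD_choose_eq_0[of 1, where ?'q = 'q] by simp
  qed
  then have "pderiv ?f = -1"
    using n by (simp add: pderiv_diff pderiv_monom)
  moreover have "P dvd pderiv ?f"
    unfolding g by (simp add: power2_eq_square pderiv_mult)
  ultimately show False using P by (simp add: prime_elem_def)
qed

section \<open>Analytic functions on \<open>A\<close> and their zeros\<close>

text \<open>
  \<open>R\<close> plays the role of the integers of \<open>K\<close> above a prime \<open>P\<close> of \<open>A\<close>, and \<open>\<pi>\<close> that of \<open>P\<close>; the map \<open>\<eta>\<close>
  is the inclusion of \<open>A\<close>. Divisibility by powers of \<open>\<pi>\<close> takes the
  place of a valuation: nonzero elements of \<open>A\<close> become units once \<open>\<pi>\<close> is inverted, and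
  only \<open>0\<close> is divisible by all powers of \<open>\<pi>\<close>. The elements \<open>t^(q^n) - t\<close> are singled out because they
  are the denominators in the recursion for the coefficients of a Drinfeld module; that they divide
  \<open>\<pi>\<close> itself, and not just a power of it, keeps these denominators small.
\<close>

locale adic_ring =
  fixes \<eta> :: "'q::finite_field poly \<Rightarrow> 'k::field" and R :: "'k set" and \<pi> :: 'k
  assumes eta_one: "\<eta> 1 = 1"
    and eta_add: "\<eta> (a + b) = \<eta> a + \<eta> b"
    and eta_mult: "\<eta> (a * b) = \<eta> a * \<eta> b"
    and R_one: "1 \<in> R"
    and R_add: "x \<in> R \<Longrightarrow> y \<in> R \<Longrightarrow> x + y \<in> R"
    and R_uminus: "x \<in> R \<Longrightarrow> - x \<in> R"
    and R_mult: "x \<in> R \<Longrightarrow> y \<in> R \<Longrightarrow> x * y \<in> R"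
    and R_eta: "\<eta> a \<in> R"
    and R_pi: "\<pi> \<in> R"
    and pi_nonzero: "\<pi> \<noteq> 0"
    and eta_dvd_pi_power: "a \<noteq> 0 \<Longrightarrow> \<exists>w\<in>R. \<exists>e. w * \<eta> a = \<pi> ^ e"
    and frobenius_minus_id_dvd_pi:
      "n > 0 \<Longrightarrow> \<exists>w\<in>R. w * (\<eta> [:0, 1:] ^ (CARD('q) ^ n) - \<eta> [:0, 1:]) = \<pi>"
    and clear_denominator: "\<exists>k. \<pi> ^ k * x \<in> R"
    and separated: "(\<And>n. \<exists>r\<in>R. x = \<pi> ^ n * r) \<Longrightarrow> x = 0"
    and finite_residues: "\<exists>T. finite T \<and> (\<forall>x\<in>R. \<exists>t\<in>T. \<exists>r\<in>R. x - t = \<pi> ^ 2 * r)"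
begin

lemma eta_zero: "\<eta> 0 = 0"
  using eta_add[of 0 0] by (metis add.right_neutral add_left_cancel)

lemma eta_uminus: "\<eta> (- a) = - \<eta> a"
  using eta_add[of a "- a"] by (simp add: eta_zero eq_neg_iff_add_eq_0 add.commute)

lemma eta_diff: "\<eta> (a - b) = \<eta> a - \<eta> b"
  using eta_add[of a "- b"] by (simp add: eta_uminus)

lemma eta_of_nat: "\<eta> (of_nat n) = of_nat n"
  by (induction n) (simp_all add: eta_zero eta_one eta_add)

lemma R_zero: "0 \<in> R"
  using R_eta[of 0] eta_zero by simp

lemma R_diff: "x \<in> R \<Longrightarrow> y \<in> R \<Longrightarrow> x - y \<in> R"
  using R_add[of x "- y"] R_uminus by simp

lemma R_power: "x \<in> R \<Longrightarrow> x ^ n \<in> R"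
  by (induction n) (auto simp: R_one R_mult)

lemma R_sum: "(\<And>i. i \<in> I \<Longrightarrow> f i \<in> R) \<Longrightarrow> (\<Sum>i\<in>I. f i) \<in> R"
  by (induction I rule: infinite_finite_induct) (auto simp: R_zero R_add)

lemmas R_closed = R_one R_zero R_add R_uminus R_diff R_mult R_eta R_pi R_power R_sum

definition pi_multiples :: "nat \<Rightarrow> 'k set" where
  "pi_multiples M = (\<lambda>r. \<pi> ^ M * r) ` R"

lemma pi_multiplesI: "r \<in> R \<Longrightarrow> \<pi> ^ M * r \<in> pi_multiples M"
  unfolding pi_multiples_def by blast

lemma pi_multiples_zero: "0 \<in> pi_multiples M"
  using pi_multiplesI[OF R_zero, of M] by simp

lemma pi_multiples_add: "x \<in> pi_multiples M \<Longrightarrow> y \<in> pi_multiples M \<Longrightarrow> x + y \<in> pi_multiples M"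
  unfolding pi_multiples_def by (auto simp: distrib_left[symmetric] intro!: imageI R_add)

lemma pi_multiples_diff: "x \<in> pi_multiples M \<Longrightarrow> y \<in> pi_multiples M \<Longrightarrow> x - y \<in> pi_multiples M"
  unfolding pi_multiples_def by (auto simp: right_diff_distrib[symmetric] intro!: imageI R_diff)

lemma pi_multiples_sum:
  "(\<And>i. i \<in> I \<Longrightarrow> f i \<in> pi_multiples M) \<Longrightarrow> (\<Sum>i\<in>I. f i) \<in> pi_multiples M"
  by (induction I rule: infinite_finite_induct) (auto simp: pi_multiples_zero pi_multiples_add)

lemma pi_multiples_mult: "x \<in> R \<Longrightarrow> y \<in> pi_multiples M \<Longrightarrow> x * y \<in> pi_multiples M"
  unfolding pi_multiples_def by (auto simp: mult.left_commute[of x] intro!: imageI R_mult)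

lemma pi_multiples_mono: "M \<le> N \<Longrightarrow> x \<in> pi_multiples N \<Longrightarrow> x \<in> pi_multiples M"
  unfolding pi_multiples_def
  by (auto simp: le_iff_add power_add mult.assoc intro!: imageI R_mult R_power R_pi)

lemma pi_multiples_subset_R: "x \<in> pi_multiples M \<Longrightarrow> x \<in> R"
  unfolding pi_multiples_def by (auto intro!: R_closed)

lemma eq_0_if_all_pi_multiples: "(\<And>M. x \<in> pi_multiples M) \<Longrightarrow> x = 0"
  by (rule separated) (auto simp: pi_multiples_def)

definition R_poly :: "'k poly \<Rightarrow> bool" where
  "R_poly F \<longleftrightarrow> (\<forall>n. Polynomial.coeff F n \<in> R)"

lemma R_poly_const: "x \<in> R \<Longrightarrow> R_poly [:x:]"
  by (auto simp: R_poly_def coeff_pCons R_closed split: nat.splits)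

lemma R_poly_X: "R_poly [:0, 1:]"
  by (auto simp: R_poly_def coeff_pCons R_closed split: nat.splits)

lemma R_poly_add: "R_poly F \<Longrightarrow> R_poly G \<Longrightarrow> R_poly (F + G)"
  by (auto simp: R_poly_def R_closed)

lemma R_poly_mult: "R_poly F \<Longrightarrow> R_poly G \<Longrightarrow> R_poly (F * G)"
  by (auto simp: R_poly_def coeff_mult intro!: R_closed)

lemma R_poly_poly: "R_poly F \<Longrightarrow> x \<in> R \<Longrightarrow> poly F x \<in> R"
  by (auto simp: R_poly_def poly_altdef intro!: R_closed)

lemma R_poly_pCons: "R_poly (pCons c F) \<longleftrightarrow> c \<in> R \<and> R_poly F"
  by (auto simp: R_poly_def coeff_pCons split: nat.splits)

lemma R_poly_pcompose: "R_poly F \<Longrightarrow> R_poly G \<Longrightarrow> R_poly (pcompose F G)"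
proof (induction F)
  case (pCons a F)
  then show ?case
    by (auto simp: R_poly_pCons pcompose_pCons intro!: R_poly_add R_poly_mult R_poly_const)
qed (simp add: R_poly_def R_closed)

lemma R_poly_synthetic_div:
  assumes "R_poly F" "x \<in> R"
  shows "R_poly (synthetic_div F x)"
  using assms(1)
proof (induction F)
  case (pCons c F)
  then show ?case using assms(2) by (simp add: R_poly_pCons R_poly_poly)
qed (simp add: R_poly_def R_closed)

text \<open>
  If \<open>F\<close> vanishes at \<open>\<pi> a\<close> for all \<open>a\<close> in the list up to a high power of \<open>\<pi>\<close>, then each \<open>F(\<pi> c)\<close> is
  divisible by \<open>\<Prod> \<pi> (c - a)\<close> up to a lower power. This follows by splitting off one root at a time:
  \<open>F(x) = (x - \<pi> a) G(x) + F(\<pi> a)\<close>, where passing to \<open>G\<close> loses only a power of \<open>\<pi>\<close> that is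
  divisible by the differences \<open>\<pi> (b - a)\<close> with the remaining roots. The loss \<open>E\<close> depends on the
  list but not on \<open>F\<close>, so it is harmless when \<open>F\<close> runs through better and better approximations.
\<close>

lemma interpolation_bound:
  assumes "distinct as"
  shows "\<exists>E. \<forall>M F c. R_poly F \<longrightarrow> (\<forall>a\<in>set as. poly F (\<pi> * \<eta> a) \<in> pi_multiples (M + E)) \<longrightarrow>
    (\<exists>r\<in>R. poly F (\<pi> * \<eta> c) - \<pi> ^ length as * r \<in> pi_multiples M)"
  using assms
proof (induction as)
  case Nil
  have "\<exists>r\<in>R. poly F (\<pi> * \<eta> c) - \<pi> ^ length [] * r \<in> pi_multiples M" if "R_poly F" for F M c
    using that by (intro bexI[of _ "poly F (\<pi> * \<eta> c)"] R_poly_poly R_closed) (simp add: pi_multiples_zero)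
  then show ?case by blast
next
  case (Cons a as)
  have "distinct as" using Cons.prems by simp
  from Cons.IH[OF this] obtain E where E: "\<forall>M F c. R_poly F \<longrightarrow> (\<forall>b\<in>set as. poly F (\<pi> * \<eta> b) \<in> pi_multiples (M + E)) \<longrightarrow>
      (\<exists>r\<in>R. poly F (\<pi> * \<eta> c) - \<pi> ^ length as * r \<in> pi_multiples M)" ..
  have "\<exists>k. \<forall>b\<in>set as. \<exists>w\<in>R. w * \<eta> (b - a) = \<pi> ^ k"
  proof -
    have "\<forall>b\<in>set as. \<exists>k. \<exists>w\<in>R. w * \<eta> (b - a) = \<pi> ^ k"
    proof
      fix b assume "b \<in> set as"
      with Cons.prems have "b - a \<noteq> 0" by auto
      from eta_dvd_pi_power[OF this] show "\<exists>k. \<exists>w\<in>R. w * \<eta> (b - a) = \<pi> ^ k" by blast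
    qed
    then obtain k where k: "\<And>b. b \<in> set as \<Longrightarrow> \<exists>w\<in>R. w * \<eta> (b - a) = \<pi> ^ k b" by metis
    show ?thesis
    proof (intro exI ballI)
      \<comment> \<open>the sum of the individual exponents works for all \<open>b\<close> at once\<close>
      fix b assume b: "b \<in> set as"
      let ?K = "\<Sum>b\<in>set as. k b"
      have le: "k b \<le> ?K" using b by (intro member_le_sum) auto
      obtain w where w: "w \<in> R" "w * \<eta> (b - a) = \<pi> ^ k b" using k[OF b] by blast
      show "\<exists>w\<in>R. w * \<eta> (b - a) = \<pi> ^ ?K"
        using w le by (intro bexI[of _ "\<pi> ^ (?K - k b) * w"])
          (auto simp: mult.assoc power_add[symmetric] intro!: R_closed)
    qed
  qed
  then obtain k where k: "\<And>b. b \<in> set as \<Longrightarrow> \<exists>w\<in>R. w * \<eta> (b - a) = \<pi> ^ k" by blast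
  show ?case
  proof (intro exI allI impI)
    fix M F c
    assume F: "R_poly F"
      and zeros: "\<forall>b\<in>set (a # as). poly F (\<pi> * \<eta> b) \<in> pi_multiples (M + (E + (k + 1)))"
    define G where "G = synthetic_div F (\<pi> * \<eta> a)"
    have G: "R_poly G" unfolding G_def using F by (intro R_poly_synthetic_div R_closed)
    have FG: "poly F x = (x - \<pi> * \<eta> a) * poly G x + poly F (\<pi> * \<eta> a)" for x
      using arg_cong[OF synthetic_div_correct'[of "\<pi> * \<eta> a" F], of "\<lambda>f. poly f x"]
      by (simp add: G_def algebra_simps)
    have "poly G (\<pi> * \<eta> b) \<in> pi_multiples (M + E)" if b: "b \<in> set as" for b
    proof -
      obtain w where w: "w \<in> R" "w * \<eta> (b - a) = \<pi> ^ k" using k[OF b] by blast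
      have "poly F (\<pi> * \<eta> b) - poly F (\<pi> * \<eta> a) \<in> pi_multiples (M + (E + (k + 1)))"
        using zeros b by (intro pi_multiples_diff) auto
      then obtain r where r: "r \<in> R"
          "poly F (\<pi> * \<eta> b) - poly F (\<pi> * \<eta> a) = \<pi> ^ (M + (E + (k + 1))) * r"
        by (auto simp: pi_multiples_def)
      have "\<pi> ^ (k + 1) * poly G (\<pi> * \<eta> b) = w * (poly F (\<pi> * \<eta> b) - poly F (\<pi> * \<eta> a))"
        unfolding FG[of "\<pi> * \<eta> b"] power_add w(2)[symmetric] by (simp add: eta_diff algebra_simps)
      also have "\<dots> = \<pi> ^ (k + 1) * (\<pi> ^ (M + E) * (w * r))"
        unfolding r(2) by (simp add: power_add algebra_simps)
      finally have "poly G (\<pi> * \<eta> b) = \<pi> ^ (M + E) * (w * r)"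
        using pi_nonzero by (simp only: mult_left_cancel power_eq_0_iff simp_thms)
      then show ?thesis using w(1) r(1) by (auto intro!: pi_multiplesI R_closed)
    qed
    from E[rule_format, OF G this] obtain r where r: "r \<in> R"
        "poly G (\<pi> * \<eta> c) - \<pi> ^ length as * r \<in> pi_multiples M" by blast
    have "poly F (\<pi> * \<eta> c) - \<pi> ^ length (a # as) * (\<eta> (c - a) * r) =
        (\<pi> * \<eta> (c - a)) * (poly G (\<pi> * \<eta> c) - \<pi> ^ length as * r) + poly F (\<pi> * \<eta> a)"
      unfolding FG[of "\<pi> * \<eta> c"] by (simp add: eta_diff algebra_simps)
    also have "\<dots> \<in> pi_multiples M"
      using r pi_multiples_mono[OF _ bspec[OF zeros, of a], of M]
      by (intro pi_multiples_add pi_multiples_mult R_closed) auto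
    finally show "\<exists>r\<in>R. poly F (\<pi> * \<eta> c) - \<pi> ^ length (a # as) * r \<in> pi_multiples M"
      using r(1) by (intro bexI[of _ "\<eta> (c - a) * r"]) (auto intro!: R_closed)
  qed
qed

text \<open>
  These are the functions that would be power series in \<open>\<pi> c\<close> over the completion of \<open>R\<close>. The
  variable is \<open>\<pi> c\<close> and not \<open>c\<close>, so that these series converge on a disc larger than the unit disc,
  which contains \<open>A\<close>; therefore all zeros in \<open>A\<close> count, whatever their residue classes.
\<close>

definition analytic :: "('q poly \<Rightarrow> 'k) \<Rightarrow> bool" where
  "analytic \<Phi> \<longleftrightarrow> (\<forall>M. \<exists>F. R_poly F \<and> (\<forall>c. \<Phi> c - poly F (\<pi> * \<eta> c) \<in> pi_multiples M))"

lemma analyticE: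
  assumes "analytic \<Phi>"
  obtains F where "R_poly F" "\<And>c. \<Phi> c - poly F (\<pi> * \<eta> c) \<in> pi_multiples M"
  using assms unfolding analytic_def by blast

lemma analytic_in_R:
  assumes "analytic \<Phi>"
  shows "\<Phi> c \<in> R"
proof -
  obtain F where F: "R_poly F" "\<And>c. \<Phi> c - poly F (\<pi> * \<eta> c) \<in> pi_multiples 0"
    using analyticE[OF assms] by blast
  have "(\<Phi> c - poly F (\<pi> * \<eta> c)) + poly F (\<pi> * \<eta> c) \<in> R"
    using F by (intro R_add R_poly_poly pi_multiples_subset_R[OF F(2)] R_closed)
  then show ?thesis by simp
qed

text \<open>
  For each \<open>N\<close>, choose \<open>N\<close> zeros and approximate \<open>\<Phi>\<close> by a polynomial modulo \<open>\<pi>^(N + E)\<close>, where \<open>E\<close> is the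
  loss for these zeros. Then every value \<open>\<Phi> c\<close> is divisible by \<open>\<pi>^N\<close>.
\<close>

lemma analytic_identity:
  assumes \<Phi>: "analytic \<Phi>" and inf: "infinite {c. \<Phi> c = 0}"
  shows "\<Phi> c = 0"
proof (rule eq_0_if_all_pi_multiples)
  fix N
  obtain S where S: "finite S" "card S = N" "S \<subseteq> {c. \<Phi> c = 0}"
    using infinite_arbitrarily_large[OF inf] by blast
  then obtain as where as: "set as = S" "distinct as" using finite_distinct_list by blast
  then have len: "length as = N" using S distinct_card by metis
  from interpolation_bound[OF as(2)] obtain E where E: "\<forall>M F c. R_poly F \<longrightarrow> (\<forall>b\<in>set as. poly F (\<pi> * \<eta> b) \<in> pi_multiples (M + E)) \<longrightarrow>
      (\<exists>r\<in>R. poly F (\<pi> * \<eta> c) - \<pi> ^ length as * r \<in> pi_multiples M)" ..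
  obtain F where F: "R_poly F" "\<And>c. \<Phi> c - poly F (\<pi> * \<eta> c) \<in> pi_multiples (N + E)"
    using analyticE[OF \<Phi>] by blast
  have "poly F (\<pi> * \<eta> b) \<in> pi_multiples (N + E)" if "b \<in> set as" for b
    using that pi_multiples_diff[OF pi_multiples_zero F(2)[of b]] S(3) as(1) by auto
  from E[rule_format, OF F(1) this] obtain r where r: "r \<in> R" "poly F (\<pi> * \<eta> c) - \<pi> ^ N * r \<in> pi_multiples N"
    using len by blast
  have "\<Phi> c = (\<Phi> c - poly F (\<pi> * \<eta> c)) + (poly F (\<pi> * \<eta> c) - \<pi> ^ N * r) + \<pi> ^ N * r" by simp
  also have "\<dots> \<in> pi_multiples N"
    using r pi_multiples_mono[OF _ F(2)[of c], of N] by (intro pi_multiples_add pi_multiplesI) auto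
  finally show "\<Phi> c \<in> pi_multiples N" .
qed

lemma analytic_const: "x \<in> R \<Longrightarrow> analytic (\<lambda>c. x)"
  unfolding analytic_def using R_poly_const[of x] by (auto intro!: exI[of _ "[:x:]"] simp: pi_multiples_zero)

lemma analytic_add:
  assumes "analytic \<Phi>" "analytic \<Psi>"
  shows "analytic (\<lambda>c. \<Phi> c + \<Psi> c)"
  unfolding analytic_def
proof
  fix M
  obtain F where F: "R_poly F" "\<And>c. \<Phi> c - poly F (\<pi> * \<eta> c) \<in> pi_multiples M"
    using analyticE[OF assms(1)] by blast
  obtain G where G: "R_poly G" "\<And>c. \<Psi> c - poly G (\<pi> * \<eta> c) \<in> pi_multiples M"
    using analyticE[OF assms(2)] by blast
  show "\<exists>F. R_poly F \<and> (\<forall>c. \<Phi> c + \<Psi> c - poly F (\<pi> * \<eta> c) \<in> pi_multiples M)"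
    using pi_multiples_add[OF F(2) G(2)] R_poly_add[OF F(1) G(1)]
    by (intro exI[of _ "F + G"]) (auto simp: algebra_simps)
qed

lemma analytic_mult:
  assumes "analytic \<Phi>" "analytic \<Psi>"
  shows "analytic (\<lambda>c. \<Phi> c * \<Psi> c)"
  unfolding analytic_def
proof
  fix M
  obtain F where F: "R_poly F" "\<And>c. \<Phi> c - poly F (\<pi> * \<eta> c) \<in> pi_multiples M"
    using analyticE[OF assms(1)] by blast
  obtain G where G: "R_poly G" "\<And>c. \<Psi> c - poly G (\<pi> * \<eta> c) \<in> pi_multiples M"
    using analyticE[OF assms(2)] by blast
  have "\<Phi> c * \<Psi> c - poly (F * G) (\<pi> * \<eta> c) \<in> pi_multiples M" for c
  proof -
    have "\<Phi> c * \<Psi> c - poly (F * G) (\<pi> * \<eta> c) =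
        \<Psi> c * (\<Phi> c - poly F (\<pi> * \<eta> c)) + poly F (\<pi> * \<eta> c) * (\<Psi> c - poly G (\<pi> * \<eta> c))"
      by (simp add: algebra_simps)
    also have "\<dots> \<in> pi_multiples M"
      using F G analytic_in_R[OF assms(2)]
      by (intro pi_multiples_add pi_multiples_mult R_poly_poly R_closed)
    finally show ?thesis .
  qed
  then show "\<exists>F. R_poly F \<and> (\<forall>c. \<Phi> c * \<Psi> c - poly F (\<pi> * \<eta> c) \<in> pi_multiples M)"
    using R_poly_mult[OF F(1) G(1)] by blast
qed

end

section \<open>Adic rings in finite extensions of the rational function field\<close>

locale fraction_field_extension =
  fixes \<iota> :: "'q::finite_field poly fract \<Rightarrow> 'k::field"
  assumes finite_extension: "finite_field_extension \<iota>"
begin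

lemma iota_add: "\<iota> (x + y) = \<iota> x + \<iota> y"
  and iota_mult: "\<iota> (x * y) = \<iota> x * \<iota> y"
  and iota_one: "\<iota> 1 = 1"
  using finite_extension by (auto simp: finite_field_extension_def ring_hom_def ring_of_type_algebra_def)

lemma iota_zero: "\<iota> 0 = 0"
  using iota_add[of 0 0] by (metis add.right_neutral add_left_cancel)

lemma iota_uminus: "\<iota> (- x) = - \<iota> x"
  using iota_add[of x "- x"] by (simp add: iota_zero eq_neg_iff_add_eq_0 add.commute)

lemma iota_diff: "\<iota> (x - y) = \<iota> x - \<iota> y"
  using iota_add[of x "- y"] by (simp add: iota_uminus)

lemma iota_power: "\<iota> (x ^ n) = \<iota> x ^ n"
  by (induction n) (simp_all add: iota_one iota_mult)

lemma iota_eq_0_iff: "\<iota> x = 0 \<longleftrightarrow> x = 0"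
proof
  assume "\<iota> x = 0"
  then have "\<iota> (x * inverse x) = 0" by (simp add: iota_mult)
  then show "x = 0" using iota_one by (metis right_inverse zero_neq_one)
qed (simp add: iota_zero)

sublocale K: vector_space "\<lambda>c x. \<iota> c * x"
  by standard (simp_all add: iota_add iota_mult iota_one algebra_simps)

lemma exists_finite_basis: "\<exists>B. finite B \<and> K.independent B \<and> K.span B = UNIV"
proof -
  obtain B0 where B0: "finite B0" "K.span B0 = UNIV"
    using finite_extension by (auto simp: finite_field_extension_def)
  obtain B where B: "B \<subseteq> B0" "K.independent B" "B0 \<subseteq> K.span B"
    by (rule K.maximal_independent_subset[of B0])
  have "K.span B0 \<subseteq> K.span B" using B(3) by (rule K.span_minimal) (rule K.subspace_span)
  then have "K.span B = UNIV" using B0(2) by auto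
  then show ?thesis using B(1,2) finite_subset[OF _ B0(1)] by blast
qed

text \<open>
  Fix a basis of \<open>K\<close> over \<open>F_q(t)\<close> and let \<open>R\<close> consist of the elements whose coordinates lie in the local
  ring at \<open>P\<close>. Only finitely many fractions have to be \<open>P\<close>-integral for \<open>R\<close> to be a ring containing \<open>S\<close>:
  the structure constants of the basis and the coordinates of \<open>1\<close> and of \<open>S\<close>. The remaining properties
  are inherited coordinatewise from the local ring.
\<close>

lemma exists_adic_ring:
  assumes "finite S"
  shows "\<exists>R \<pi>. adic_ring (\<lambda>a. \<iota> (Fract a 1)) R \<pi> \<and> S \<subseteq> R"
proof -
  obtain B where B: "finite B" "K.independent B" "K.span B = UNIV"
    using exists_finite_basis by blast
  define co where "co = K.representation B"
  have co_add: "co (x + y) d = co x d + co y d" for x y d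
    using B by (simp add: co_def K.representation_add)
  have co_scale: "co (\<iota> c * x) d = c * co x d" for c x d
    using B by (simp add: co_def K.representation_scale)
  have co_zero: "co 0 d = 0" for d
    by (simp add: co_def K.representation_zero)
  have co_uminus: "co (- x) d = - co x d" for x d
    using co_add[of x "- x" d] by (simp add: co_zero eq_neg_iff_add_eq_0 add.commute)
  have co_sum: "co (\<Sum>i\<in>I. f i) d = (\<Sum>i\<in>I. co (f i) d)" for I d and f :: "'k \<Rightarrow> 'k"
    by (induction I rule: infinite_finite_induct) (simp_all add: co_zero co_add)
  have expand: "(\<Sum>b\<in>B. \<iota> (co x b) * b) = x" for x
    using B by (simp add: co_def K.sum_representation_eq)
  have co_basis: "co b d = (if b = d then 1 else 0)" if "b \<in> B" for b d
    using that B by (auto simp: co_def K.representation_basis)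

  define D where "D = (\<Union>b\<in>B. \<Union>c\<in>B. co (b * c) ` B) \<union> co 1 ` B \<union> (\<Union>s\<in>S. co s ` B)"
  have "finite D" unfolding D_def using B(1) assms by (intro finite_UnI finite_UN_I finite_imageI)
  then obtain P where P: "prime_elem P" "D \<subseteq> localization P"
    using exists_localization_containing by blast
  define R where "R = {x. \<forall>d\<in>B. co x d \<in> localization P}"
  define \<pi> where "\<pi> = \<iota> (Fract P 1)"
  note loc = localization_integer[OF P(1)] localization_add[OF P(1)] localization_mult[OF P(1)]
    localization_uminus[OF P(1)] localization_sum[OF P(1)]
  have R_one: "1 \<in> R" and R_S: "S \<subseteq> R" and R_basis_mult: "\<And>b c. b \<in> B \<Longrightarrow> c \<in> B \<Longrightarrow> b * c \<in> R"
    using P(2) by (auto simp: R_def D_def UN_subset_iff image_subset_iff)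
  have R_scale: "\<iota> c * x \<in> R" if "c \<in> localization P" "x \<in> R" for c x
    using that by (auto simp: R_def co_scale intro!: loc)
  have R_iota: "\<iota> c \<in> R" if "c \<in> localization P" for c
    using R_scale[OF that R_one] by simp
  have R_add: "x + y \<in> R" if "x \<in> R" "y \<in> R" for x y
    using that by (auto simp: R_def co_add intro!: loc)
  have R_sum: "(\<Sum>i\<in>I. f i) \<in> R" if "\<And>i. i \<in> I \<Longrightarrow> f i \<in> R" for I and f :: "'k \<Rightarrow> 'k"
    using that by (auto simp: R_def co_sum intro!: loc)
  have one_loc: "1 \<in> localization P" "0 \<in> localization P"
    using loc(1)[of 1] loc(1)[of 0] by (simp_all add: One_fract_def Zero_fract_def)
  have pi_power: "\<pi> ^ n = \<iota> (Fract P 1 ^ n)" for n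
    by (simp add: \<pi>_def iota_power)
  have P0: "P \<noteq> 0" using P(1) by (simp add: prime_elem_def)

  have "adic_ring (\<lambda>a. \<iota> (Fract a 1)) R \<pi>"
  proof
    show "\<iota> (Fract 1 1) = 1" using iota_one by (simp add: One_fract_def)
    show "\<iota> (Fract (a + b) 1) = \<iota> (Fract a 1) + \<iota> (Fract b 1)" for a b
      by (simp flip: iota_add)
    show "\<iota> (Fract (a * b) 1) = \<iota> (Fract a 1) * \<iota> (Fract b 1)" for a b
      by (simp flip: iota_mult)
    show "1 \<in> R" by (rule R_one)
    show "x + y \<in> R" if "x \<in> R" "y \<in> R" for x y using that by (rule R_add)
    show "- x \<in> R" if "x \<in> R" for x
      using that by (auto simp: R_def co_uminus intro!: loc)
    show "x * y \<in> R" if "x \<in> R" "y \<in> R" for x y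
    proof -
      have "x * y = (\<Sum>b\<in>B. \<iota> (co x b) * b) * (\<Sum>c\<in>B. \<iota> (co y c) * c)"
        unfolding expand ..
      also have "\<dots> = (\<Sum>b\<in>B. \<Sum>c\<in>B. \<iota> (co x b) * (\<iota> (co y c) * (b * c)))"
        by (simp add: sum_product mult_ac)
      also have "\<dots> \<in> R"
        using that by (intro R_sum R_scale R_basis_mult) (auto simp: R_def)
      finally show ?thesis .
    qed
    show "\<iota> (Fract a 1) \<in> R" for a by (intro R_iota loc)
    show "\<pi> \<in> R" unfolding \<pi>_def by (intro R_iota loc)
    show "\<pi> \<noteq> 0" using P0 by (simp add: \<pi>_def iota_eq_0_iff Zero_fract_def eq_fract)
    show "\<exists>w\<in>R. \<exists>e. w * \<iota> (Fract a 1) = \<pi> ^ e" if nz: "a \<noteq> 0" for a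
    proof -
      obtain e a' where a': "a = P ^ e * a'" "\<not> P dvd a'"
        using prime_power_decompose[OF P(1) nz] by blast
      have "Fract 1 a' * Fract a 1 = Fract P 1 ^ e"
        using a' nz by (simp add: Fract_power eq_fract)
      then have "\<iota> (Fract 1 a') * \<iota> (Fract a 1) = \<pi> ^ e"
        unfolding pi_power iota_mult[symmetric] by simp
      then show ?thesis using R_iota[OF Fract_in_localization[OF a'(2)]] by blast
    qed
    show "\<exists>w\<in>R. w * (\<iota> (Fract [:0, 1:] 1) ^ (CARD('q) ^ n) - \<iota> (Fract [:0, 1:] 1)) = \<pi>"
      if "n > 0" for n
    proof -
      define f :: "'q poly" where "f = Polynomial.monom 1 (CARD('q) ^ n) - Polynomial.monom 1 1"
      have sq: "\<not> P ^ 2 dvd f"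
        unfolding f_def using P(1) that by (rule frobenius_minus_id_squarefree)
      then have "f \<noteq> 0" by auto
      then obtain e f' where f': "f = P ^ e * f'" "\<not> P dvd f'"
        using prime_power_decompose[OF P(1)] by blast
      \<comment> \<open>\<open>P\<close> divides \<open>f\<close> at most once, so \<open>P / f\<close> has a denominator prime to \<open>P\<close>\<close>
      have "e \<le> 1"
      proof (rule ccontr)
        assume "\<not> e \<le> 1"
        then have "P ^ 2 dvd P ^ e" by (intro le_imp_power_dvd) simp
        then show False using sq f'(1) by simp
      qed
      then have "P ^ (1 - e) * P ^ e = P" by (simp flip: power_add)
      moreover have "f' \<noteq> 0" using f'(2) by auto
      ultimately have "Fract (P ^ (1 - e)) f' * Fract f 1 = Fract P 1"
        by (simp add: f'(1) eq_fract mult.assoc[symmetric])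
      then have "\<iota> (Fract (P ^ (1 - e)) f') * \<iota> (Fract f 1) = \<pi>"
        unfolding \<pi>_def iota_mult[symmetric] by simp
      moreover have "\<iota> (Fract f 1) = \<iota> (Fract [:0, 1:] 1) ^ (CARD('q) ^ n) - \<iota> (Fract [:0, 1:] 1)"
        by (simp add: f_def Fract_power monom_altdef flip: iota_power iota_diff)
      ultimately show ?thesis using R_iota[OF Fract_in_localization[OF f'(2)]] by metis
    qed
    show "\<exists>k. \<pi> ^ k * x \<in> R" for x
    proof -
      have "\<forall>d. \<exists>k. Fract P 1 ^ k * co x d \<in> localization P"
        using localization_clear_denominator[OF P(1)] by blast
      then obtain k where k: "\<And>d. Fract P 1 ^ k d * co x d \<in> localization P"
        using choice[of "\<lambda>d k. Fract P 1 ^ k * co x d \<in> localization P"] by blast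
      have "Fract P 1 ^ (\<Sum>d\<in>B. k d) * co x d \<in> localization P" if "d \<in> B" for d
      proof -
        have "k d \<le> (\<Sum>d\<in>B. k d)" using that B(1) by (intro member_le_sum) auto
        then have "Fract P 1 ^ (\<Sum>d\<in>B. k d) * co x d =
            Fract (P ^ ((\<Sum>d\<in>B. k d) - k d)) 1 * (Fract P 1 ^ k d * co x d)"
          by (simp add: mult.assoc[symmetric] flip: power_add Fract_power)
        moreover have "\<dots> \<in> localization P" by (intro loc k)
        ultimately show ?thesis by (simp only:)
      qed
      then show ?thesis by (intro exI[of _ "\<Sum>d\<in>B. k d"]) (simp add: R_def pi_power co_scale)
    qed
    show "x = 0" if "\<And>n. \<exists>r\<in>R. x = \<pi> ^ n * r" for x
    proof -
      have "co x d = 0" if d: "d \<in> B" for d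
      proof (rule localization_separated[OF P(1)])
        fix n
        obtain r where "r \<in> R" "x = \<pi> ^ n * r" using \<open>\<And>n. \<exists>r\<in>R. x = \<pi> ^ n * r\<close> by blast
        then show "\<exists>y\<in>localization P. co x d = Fract P 1 ^ n * y"
          using d by (auto simp: R_def pi_power co_scale)
      qed
      then show ?thesis using expand[of x] by (simp add: iota_zero)
    qed
    show "\<exists>T. finite T \<and> (\<forall>x\<in>R. \<exists>t\<in>T. \<exists>r\<in>R. x - t = \<pi> ^ 2 * r)"
    proof (intro exI conjI ballI)
      let ?Q = "{r. Polynomial.degree r < Polynomial.degree (P ^ 2)}"
      let ?t = "\<lambda>f. \<Sum>b\<in>B. \<iota> (Fract (f b) 1) * b"
      show "finite (?t ` (PiE B (\<lambda>_. ?Q)))"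
        using B(1) finite_poly_degree_less by (intro finite_imageI finite_PiE)
      fix x assume x: "x \<in> R"
      have "\<forall>d\<in>B. \<exists>r. r \<in> ?Q \<and> (\<exists>y\<in>localization P. co x d - Fract r 1 = Fract P 1 ^ 2 * y)"
        using localization_residues[OF P(1)] x by (auto simp: R_def)
      then obtain r y where r: "\<And>d. d \<in> B \<Longrightarrow> r d \<in> ?Q" and y: "\<And>d. d \<in> B \<Longrightarrow> y d \<in> localization P"
          and eq: "\<And>d. d \<in> B \<Longrightarrow> co x d - Fract (r d) 1 = Fract P 1 ^ 2 * y d" by metis
      have "?t (restrict r B) = (\<Sum>b\<in>B. \<iota> (Fract (r b) 1) * b)"
        by (intro sum.cong) simp_all
      then have "x - ?t (restrict r B) = (\<Sum>b\<in>B. \<iota> (co x b) * b) - (\<Sum>b\<in>B. \<iota> (Fract (r b) 1) * b)"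
        unfolding expand by (simp only:)
      also have "\<dots> = (\<Sum>b\<in>B. \<iota> (co x b - Fract (r b) 1) * b)"
        by (simp add: iota_diff left_diff_distrib sum_subtractf)
      also have "\<dots> = \<pi> ^ 2 * (\<Sum>b\<in>B. \<iota> (y b) * b)"
        unfolding sum_distrib_left by (intro sum.cong) (simp_all only: eq pi_power iota_mult mult.assoc)
      finally have "x - ?t (restrict r B) = \<pi> ^ 2 * (\<Sum>b\<in>B. \<iota> (y b) * b)" .
      moreover have "(\<Sum>b\<in>B. \<iota> (y b) * b) \<in> R"
        using y one_loc by (intro R_sum R_scale) (auto simp: R_def co_basis)
      moreover have "?t (restrict r B) \<in> ?t ` (PiE B (\<lambda>_. ?Q))"
        using r by (intro imageI) auto
      ultimately show "\<exists>t\<in>?t ` (PiE B (\<lambda>_. ?Q)). \<exists>r\<in>R. x - t = \<pi> ^ 2 * r" by blast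
    qed
  qed
  with R_S show ?thesis by blast
qed

end

section \<open>Drinfeld modules as analytic functions\<close>

lemma infinite_UNIV_poly: "infinite (UNIV :: 'a::comm_semiring_1 poly set)"
proof
  assume "finite (UNIV :: 'a poly set)"
  then have "finite (range (\<lambda>n. Polynomial.monom (1 :: 'a) n))" by (rule finite_subset[rotated]) simp
  moreover have "inj (\<lambda>n. Polynomial.monom (1 :: 'a) n)"
    by (rule injI) (metis degree_monom_eq one_neq_zero)
  ultimately show False using finite_imageD infinite_UNIV_nat by blast
qed

context
  assumes char: "\<And>n. of_nat n = (0 :: 'q::finite_field) \<Longrightarrow> of_nat n = (0 :: 'k::field)"
begin

lemma coeff_frobenius_power:
  fixes g :: "'k poly"
  shows "Polynomial.coeff (g ^ (CARD('q) ^ i)) (CARD('q) ^ n) =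
    (if i \<le> n then Polynomial.coeff g (CARD('q) ^ (n - i)) ^ (CARD('q) ^ i) else 0)"
proof -
  let ?q = "CARD('q)"
  have q: "2 \<le> ?q" by (rule CARD_ge_2)
  have "g ^ (?q ^ i) = (\<Sum>m\<le>Polynomial.degree g.
      Polynomial.monom (Polynomial.coeff g m ^ (?q ^ i)) (m * ?q ^ i))"
    by (subst poly_as_sum_of_monoms[of g, symmetric])
       (simp add: frobenius_sum[OF char_poly, OF char] monom_power)
  then have *: "Polynomial.coeff (g ^ (?q ^ i)) (?q ^ n) =
      (\<Sum>m\<le>Polynomial.degree g. if m * ?q ^ i = ?q ^ n then Polynomial.coeff g m ^ (?q ^ i) else 0)"
    by (simp add: coeff_sum)
  show ?thesis
  proof (cases "i \<le> n")
    case True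
    then have "m * ?q ^ i = ?q ^ n \<longleftrightarrow> m = ?q ^ (n - i)" for m
      using q by (auto simp: le_iff_add power_add)
    then have "Polynomial.coeff (g ^ (?q ^ i)) (?q ^ n) =
        (if ?q ^ (n - i) \<le> Polynomial.degree g then Polynomial.coeff g (?q ^ (n - i)) ^ (?q ^ i) else 0)"
      unfolding * by (simp add: sum.delta)
    then show ?thesis using True by (auto simp: coeff_eq_0)
  next
    case False
    have "m * ?q ^ i \<noteq> ?q ^ n" for m
    proof
      assume eq: "m * ?q ^ i = ?q ^ n"
      then have "?q ^ i dvd ?q ^ n" by (metis dvd_triv_right)
      then have "i \<le> n" using q by (simp add: power_dvd_imp_le)
      with False show False by simp
    qed
    then show ?thesis unfolding * using False by simp
  qed
qed

text \<open>
  The product in \<open>K{\<tau>}\<close>, governed by \<open>\<tau>\<^sup>i b = b^(q^i) \<tau>\<^sup>i\<close>.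
\<close>

lemma coeff_pcompose_tau_ring:
  fixes f g :: "'k poly"
  assumes f: "f \<in> carrier (tau_ring CARD('q))"
  shows "Polynomial.coeff (pcompose f g) (CARD('q) ^ n) =
    (\<Sum>i\<le>n. Polynomial.coeff f (CARD('q) ^ i) * Polynomial.coeff g (CARD('q) ^ (n - i)) ^ (CARD('q) ^ i))"
proof -
  let ?q = "CARD('q)"
  have q: "2 \<le> ?q" by (rule CARD_ge_2)
  have inj: "inj_on (\<lambda>i. ?q ^ i) {..n}"
    using q by (auto intro!: inj_onI)
  have "Polynomial.coeff (pcompose f g) (?q ^ n) =
      (\<Sum>m\<le>Polynomial.degree f. Polynomial.coeff f m * Polynomial.coeff (g ^ m) (?q ^ n))"
    by (simp add: pcompose_conv_sum coeff_sum)
  also have "\<dots> = (\<Sum>m\<in>(\<lambda>i. ?q ^ i) ` {..n}. Polynomial.coeff f m * Polynomial.coeff (g ^ m) (?q ^ n))"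
  proof (rule sum.mono_neutral_cong)
    fix m assume m: "m \<in> {..Polynomial.degree f} - (\<lambda>i. ?q ^ i) ` {..n}"
    show "Polynomial.coeff f m * Polynomial.coeff (g ^ m) (?q ^ n) = 0"
    proof (cases "Polynomial.coeff f m = 0")
      case False
      then obtain i where i: "m = ?q ^ i" using f by (auto simp: tau_ring_def)
      with m have "\<not> i \<le> n" by auto
      then show ?thesis by (simp add: i coeff_frobenius_power)
    qed simp
  qed (auto simp: coeff_eq_0)
  also have "\<dots> = (\<Sum>i\<le>n. Polynomial.coeff f (?q ^ i) * Polynomial.coeff (g ^ (?q ^ i)) (?q ^ n))"
    using inj by (simp add: sum.reindex)
  also have "\<dots> = (\<Sum>i\<le>n. Polynomial.coeff f (?q ^ i) * Polynomial.coeff g (?q ^ (n - i)) ^ (?q ^ i))"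
    by (intro sum.cong) (simp_all add: coeff_frobenius_power)
  finally show ?thesis .
qed

end

text \<open>
  It suffices that \<open>\<phi>\<close> is integral on \<open>t\<close> and on the constants, which are finitely many conditions: these
  elements generate \<open>A\<close>, and polynomials over \<open>R\<close> are closed under composition.
\<close>

locale adic_drinfeld_module = adic_ring \<eta> R \<pi>
  for \<eta> :: "'q::finite_field poly \<Rightarrow> 'k::field" and R \<pi> +
  fixes \<phi> :: "'q poly \<Rightarrow> 'k poly"
  assumes phi_tau: "\<phi> a \<in> carrier (tau_ring CARD('q))"
    and phi_add: "\<phi> (a + b) = \<phi> a + \<phi> b"
    and phi_mult: "\<phi> (a * b) = pcompose (\<phi> a) (\<phi> b)"
    and coeff_phi_1: "Polynomial.coeff (\<phi> a) 1 = \<eta> a"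
    and R_poly_phi_X: "R_poly (\<phi> [:0, 1:])"
    and R_poly_phi_const: "R_poly (\<phi> [:c:])"
begin

lemma char: "of_nat n = (0 :: 'q) \<Longrightarrow> of_nat n = (0 :: 'k)"
  using eta_of_nat[of n] by (simp add: of_nat_poly eta_zero)

lemma R_poly_phi: "R_poly (\<phi> a)"
proof (induction a)
  case 0
  show ?case using R_poly_phi_const[of 0] by simp
next
  case (pCons c a)
  have "\<phi> (pCons c a) = \<phi> [:c:] + pcompose (\<phi> [:0, 1:]) (\<phi> a)"
    by (simp flip: phi_add phi_mult)
  then show ?case using pCons.IH R_poly_phi_X R_poly_phi_const
    by (simp add: R_poly_add R_poly_pcompose)
qed

text \<open>
  The coefficient of \<open>\<tau>\<^sup>n\<close> in \<open>\<phi>\<^sub>c\<close>.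
\<close>

abbreviation (input) D :: "nat \<Rightarrow> 'q poly \<Rightarrow> 'k" where
  "D n c \<equiv> Polynomial.coeff (\<phi> c) (CARD('q) ^ n)"

text \<open>
  Compare the coefficients of \<open>\<tau>\<^sup>n\<close> in \<open>\<phi>\<^sub>t \<phi>\<^sub>c = \<phi>\<^sub>c \<phi>\<^sub>t\<close>. On either side \<open>D\<^sub>n(c)\<close> occurs in one term only, with
  factor \<open>t\<close> on the left and \<open>t^(q^n)\<close> on the right; so this is a recursion for \<open>D\<^sub>n(c)\<close>.
\<close>

lemma commutation:
  "(\<eta> [:0, 1:] ^ (CARD('q) ^ n) - \<eta> [:0, 1:]) * D n c =
     (\<Sum>i\<in>{1..n}. D i [:0, 1:] * D (n - i) c ^ (CARD('q) ^ i)) -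
     (\<Sum>j<n. D j c * D (n - j) [:0, 1:] ^ (CARD('q) ^ j))"
proof -
  let ?t = "[:0, 1:] :: 'q poly"
  have "pcompose (\<phi> ?t) (\<phi> c) = pcompose (\<phi> c) (\<phi> ?t)"
    by (metis phi_mult mult.commute)
  from arg_cong[OF this, of "\<lambda>f. Polynomial.coeff f (CARD('q) ^ n)"]
  have "(\<Sum>i\<le>n. D i ?t * D (n - i) c ^ (CARD('q) ^ i)) = (\<Sum>j\<le>n. D j c * D (n - j) ?t ^ (CARD('q) ^ j))"
    by (simp only: coeff_pcompose_tau_ring[OF char phi_tau])
  moreover have "(\<Sum>i\<le>n. D i ?t * D (n - i) c ^ (CARD('q) ^ i)) =
      \<eta> ?t * D n c + (\<Sum>i\<in>{1..n}. D i ?t * D (n - i) c ^ (CARD('q) ^ i))"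
    by (simp add: atMost_atLeast0 sum.atLeast_Suc_atMost coeff_phi_1[unfolded One_nat_def])
  moreover have "(\<Sum>j\<le>n. D j c * D (n - j) ?t ^ (CARD('q) ^ j)) =
      (\<Sum>j<n. D j c * D (n - j) ?t ^ (CARD('q) ^ j)) + D n c * \<eta> ?t ^ (CARD('q) ^ n)"
    by (simp add: lessThan_Suc_atMost[symmetric] coeff_phi_1[unfolded One_nat_def])
  ultimately show ?thesis by (simp add: algebra_simps)
qed

text \<open>
  The analytic functions that are equal to a polynomial, not only approximated by polynomials.
\<close>

definition scaled_polynomial :: "('q poly \<Rightarrow> 'k) \<Rightarrow> bool" where
  "scaled_polynomial \<Phi> \<longleftrightarrow> (\<exists>F. R_poly F \<and> (\<forall>c. \<Phi> c = poly F (\<pi> * \<eta> c)))"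

lemma scaled_polynomial_const: "x \<in> R \<Longrightarrow> scaled_polynomial (\<lambda>c. x)"
  unfolding scaled_polynomial_def by (intro exI[of _ "[:x:]"]) (simp add: R_poly_const)

lemma scaled_polynomial_add:
  assumes "scaled_polynomial \<Phi>" "scaled_polynomial \<Psi>"
  shows "scaled_polynomial (\<lambda>c. \<Phi> c + \<Psi> c)"
proof -
  from assms obtain F G where "R_poly F" "R_poly G" "\<And>c. \<Phi> c = poly F (\<pi> * \<eta> c)" "\<And>c. \<Psi> c = poly G (\<pi> * \<eta> c)"
    unfolding scaled_polynomial_def by blast
  then show ?thesis unfolding scaled_polynomial_def
    by (intro exI[of _ "F + G"]) (simp add: R_poly_add)
qed

lemma scaled_polynomial_mult:
  assumes "scaled_polynomial \<Phi>" "scaled_polynomial \<Psi>"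
  shows "scaled_polynomial (\<lambda>c. \<Phi> c * \<Psi> c)"
proof -
  from assms obtain F G where "R_poly F" "R_poly G" "\<And>c. \<Phi> c = poly F (\<pi> * \<eta> c)" "\<And>c. \<Psi> c = poly G (\<pi> * \<eta> c)"
    unfolding scaled_polynomial_def by blast
  then show ?thesis unfolding scaled_polynomial_def
    by (intro exI[of _ "F * G"]) (simp add: R_poly_mult)
qed

lemma scaled_polynomial_scale: "x \<in> R \<Longrightarrow> scaled_polynomial \<Phi> \<Longrightarrow> scaled_polynomial (\<lambda>c. x * \<Phi> c)"
  by (rule scaled_polynomial_mult[OF scaled_polynomial_const])

lemma scaled_polynomial_power: "scaled_polynomial \<Phi> \<Longrightarrow> scaled_polynomial (\<lambda>c. \<Phi> c ^ n)"
  by (induction n) (auto intro: scaled_polynomial_const R_one scaled_polynomial_mult)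

lemma scaled_polynomial_sum:
  "(\<And>i. i \<in> I \<Longrightarrow> scaled_polynomial (\<Phi> i)) \<Longrightarrow> scaled_polynomial (\<lambda>c. \<Sum>i\<in>I. \<Phi> i c)"
  by (induction I rule: infinite_finite_induct) (auto intro: scaled_polynomial_const R_zero scaled_polynomial_add)

text \<open>
  By the recursion, \<open>\<pi>^(q^n - 1) D\<^sub>n\<close> is a polynomial in \<open>c\<close> of degree at most \<open>q^n\<close> over \<open>R\<close>, and rewriting
  it as a polynomial in \<open>\<pi> c\<close> costs another \<open>\<pi>^(q^n)\<close>. With \<open>u\<^sub>n = 2 q^n - 1\<close> the induction closes because
  division by \<open>t^(q^n) - t\<close> costs one factor \<open>\<pi>\<close>, and \<open>1 + q^i u\<^sub>n\<^sub>-\<^sub>i \<le> u\<^sub>n\<close> for \<open>i \<ge> 1\<close> and \<open>1 + u\<^sub>j \<le> u\<^sub>n\<close> for \<open>j < n\<close>.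
\<close>

lemma scaled_polynomial_coeff: "scaled_polynomial (\<lambda>c. \<pi> ^ (2 * CARD('q) ^ n - 1) * D n c)"
proof (induction n rule: less_induct)
  case (less n)
  let ?q = "CARD('q)" and ?t = "[:0, 1:] :: 'q poly"
  have q: "2 \<le> ?q" by (rule CARD_ge_2)
  show ?case
  proof (cases "n = 0")
    case True
    then show ?thesis
      unfolding scaled_polynomial_def
      by (intro exI[of _ "[:0, 1:]"]) (simp add: R_poly_X coeff_phi_1[unfolded One_nat_def])
  next
    case False
    then obtain w where w: "w \<in> R" "w * (\<eta> ?t ^ (?q ^ n) - \<eta> ?t) = \<pi>"
      using frobenius_minus_id_dvd_pi[of n] by auto
    have Dt: "D i ?t \<in> R" for i using R_poly_phi[of ?t] by (simp add: R_poly_def)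
    define e where "e = 2 * ?q ^ n - 2"
    have qn: "1 \<le> ?q ^ j" for j using q by simp
    have e1: "2 * ?q ^ n - 1 = e + 1"
      using qn[of n] unfolding e_def by linarith
    have "\<pi> ^ (2 * ?q ^ n - 1) * D n c = w * (\<pi> ^ e * ((\<eta> ?t ^ (?q ^ n) - \<eta> ?t) * D n c))" for c
    proof -
      have "\<pi> ^ (2 * ?q ^ n - 1) = \<pi> ^ e * (w * (\<eta> ?t ^ (?q ^ n) - \<eta> ?t))"
        unfolding w(2) e1 by simp
      then show ?thesis by (simp add: mult_ac)
    qed
    also have "\<dots> c = w * (\<Sum>i\<in>{1..n}. D i ?t * (\<pi> ^ e * D (n - i) c ^ (?q ^ i))) +
        (- w) * (\<Sum>j<n. D (n - j) ?t ^ (?q ^ j) * (\<pi> ^ e * D j c))" for c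
      unfolding commutation by (simp add: algebra_simps sum_distrib_left sum_negf)
    finally have eq: "\<pi> ^ (2 * ?q ^ n - 1) * D n c =
        w * (\<Sum>i\<in>{1..n}. D i ?t * (\<pi> ^ e * D (n - i) c ^ (?q ^ i))) +
        (- w) * (\<Sum>j<n. D (n - j) ?t ^ (?q ^ j) * (\<pi> ^ e * D j c))" for c .
    have s1: "scaled_polynomial (\<lambda>c. \<pi> ^ e * D (n - i) c ^ (?q ^ i))" if i: "i \<in> {1..n}" for i
    proof -
      have "?q ^ 1 \<le> ?q ^ i" using q i by (intro power_increasing) auto
      then have "2 \<le> ?q ^ i" using q by simp
      then obtain a where a: "?q ^ i = a + 2" by (metis le_add_diff_inverse2)
      obtain b where b: "?q ^ (n - i) = b + 1" using qn by (metis le_add_diff_inverse2)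
      have "?q ^ n = ?q ^ i * ?q ^ (n - i)" using i by (simp flip: power_add)
      then have "e = (?q ^ i - 2) + (2 * ?q ^ (n - i) - 1) * ?q ^ i"
        unfolding e_def a b by (simp add: algebra_simps)
      then have "\<pi> ^ e * D (n - i) c ^ (?q ^ i) =
          \<pi> ^ (?q ^ i - 2) * (\<pi> ^ (2 * ?q ^ (n - i) - 1) * D (n - i) c) ^ (?q ^ i)" for c
        by (simp add: power_add power_mult power_mult_distrib)
      moreover have "scaled_polynomial (\<lambda>c. \<pi> ^ (?q ^ i - 2) *
          (\<pi> ^ (2 * ?q ^ (n - i) - 1) * D (n - i) c) ^ (?q ^ i))"
        using i False
        by (intro scaled_polynomial_mult scaled_polynomial_power scaled_polynomial_const less.IH R_closed) auto
      ultimately show ?thesis by simp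
    qed
    have s2: "scaled_polynomial (\<lambda>c. \<pi> ^ e * D j c)" if j: "j < n" for j
    proof -
      have "?q ^ j < ?q ^ n" using q j by (intro power_strict_increasing) auto
      then have "e = (e - (2 * ?q ^ j - 1)) + (2 * ?q ^ j - 1)"
        using qn[of j] unfolding e_def by linarith
      then have "\<pi> ^ e = \<pi> ^ (e - (2 * ?q ^ j - 1)) * \<pi> ^ (2 * ?q ^ j - 1)"
        by (metis power_add)
      moreover have "scaled_polynomial (\<lambda>c. \<pi> ^ (e - (2 * ?q ^ j - 1)) * (\<pi> ^ (2 * ?q ^ j - 1) * D j c))"
        using j by (intro scaled_polynomial_mult scaled_polynomial_const less.IH R_closed)
      ultimately show ?thesis by (simp only: mult.assoc)
    qed
    have "scaled_polynomial (\<lambda>c. \<Sum>i\<in>{1..n}. D i ?t * (\<pi> ^ e * D (n - i) c ^ (?q ^ i)))"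
      by (rule scaled_polynomial_sum) (rule scaled_polynomial_scale[OF Dt s1])
    moreover have "scaled_polynomial (\<lambda>c. \<Sum>j<n. D (n - j) ?t ^ (?q ^ j) * (\<pi> ^ e * D j c))"
      by (rule scaled_polynomial_sum) (auto intro!: scaled_polynomial_scale[OF R_power[OF Dt]] s2)
    ultimately show ?thesis unfolding eq
      by (intro scaled_polynomial_add scaled_polynomial_scale R_uminus w(1))
  qed
qed

lemma poly_phi_conv_sum:
  assumes N: "Polynomial.degree (\<phi> c) < N"
  shows "poly (\<phi> c) x = (\<Sum>n<N. D n c * x ^ (CARD('q) ^ n))"
proof -
  let ?q = "CARD('q)"
  have q: "2 \<le> ?q" by (rule CARD_ge_2)
  have inj: "inj_on (\<lambda>i. ?q ^ i) {..<N}" using q by (auto intro!: inj_onI)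
  have lt: "n < ?q ^ n" for n using q by (intro power_gt_expt) auto
  have "poly (\<phi> c) x = (\<Sum>m\<le>Polynomial.degree (\<phi> c). Polynomial.coeff (\<phi> c) m * x ^ m)"
    by (rule poly_altdef)
  also have "\<dots> = (\<Sum>m\<in>(\<lambda>i. ?q ^ i) ` {..<N}. Polynomial.coeff (\<phi> c) m * x ^ m)"
  proof (rule sum.mono_neutral_cong)
    fix m assume m: "m \<in> {..Polynomial.degree (\<phi> c)} - (\<lambda>i. ?q ^ i) ` {..<N}"
    show "Polynomial.coeff (\<phi> c) m * x ^ m = 0"
    proof (cases "Polynomial.coeff (\<phi> c) m = 0")
      case False
      then obtain i where i: "m = ?q ^ i" using phi_tau[of c] by (auto simp: tau_ring_def)
      with m have "N \<le> i" by force
      with N lt[of i] i m show ?thesis by auto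
    qed simp
  qed (auto simp: coeff_eq_0)
  also have "\<dots> = (\<Sum>n<N. D n c * x ^ (?q ^ n))"
    using inj by (simp add: sum.reindex)
  finally show ?thesis .
qed

text \<open>
  In \<open>\<phi>\<^sub>c(x) = \<Sum> D\<^sub>n(c) x^(q^n)\<close> the factor \<open>x^(q^n)\<close> is divisible by \<open>\<pi>^(2 q^n)\<close>. This clears the denominators
  of the polynomial \<open>D\<^sub>n\<close>, so each term is a polynomial in \<open>\<pi> c\<close>; and since the values \<open>D\<^sub>n(c)\<close> are in
  \<open>R\<close>, the tail of the sum is small uniformly in \<open>c\<close>, although the number of nonzero terms grows with
  the degree of \<open>c\<close>.
\<close>

lemma analytic_phi:
  assumes x: "x \<in> pi_multiples 2"
  shows "analytic (\<lambda>c. poly (\<phi> c) x)"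
  unfolding analytic_def
proof
  fix M
  let ?q = "CARD('q)"
  obtain r where r: "r \<in> R" "x = \<pi> ^ 2 * r" using x by (auto simp: pi_multiples_def)
  have xpow: "x ^ (?q ^ n) = \<pi> ^ (2 * ?q ^ n) * r ^ (?q ^ n)" for n
    by (simp add: r(2) power_mult_distrib power_mult)
  have "scaled_polynomial (\<lambda>c. \<Sum>n<M. D n c * x ^ (?q ^ n))"
  proof (intro scaled_polynomial_sum)
    fix n
    have "2 * ?q ^ n = Suc (2 * ?q ^ n - 1)" by simp
    then have "\<pi> ^ (2 * ?q ^ n) = \<pi> * \<pi> ^ (2 * ?q ^ n - 1)" by (metis power_Suc)
    then have "D n c * x ^ (?q ^ n) = (\<pi> * r ^ (?q ^ n)) * (\<pi> ^ (2 * ?q ^ n - 1) * D n c)" for c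
      unfolding xpow by (simp add: mult_ac)
    then show "scaled_polynomial (\<lambda>c. D n c * x ^ (?q ^ n))"
      using r(1)
      by (simp only:) (intro scaled_polynomial_mult scaled_polynomial_const scaled_polynomial_coeff R_closed)
  qed
  then obtain F where F: "R_poly F" "\<And>c. (\<Sum>n<M. D n c * x ^ (?q ^ n)) = poly F (\<pi> * \<eta> c)"
    unfolding scaled_polynomial_def by blast
  have "poly (\<phi> c) x - poly F (\<pi> * \<eta> c) \<in> pi_multiples M" for c
  proof -
    define N where "N = max M (Suc (Polynomial.degree (\<phi> c)))"
    have "poly (\<phi> c) x = (\<Sum>n<N. D n c * x ^ (?q ^ n))"
      by (rule poly_phi_conv_sum) (simp add: N_def)
    also have "\<dots> = (\<Sum>n<M. D n c * x ^ (?q ^ n)) + (\<Sum>n\<in>{M..<N}. D n c * x ^ (?q ^ n))"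
      unfolding atLeast0LessThan[symmetric] by (rule sum.atLeastLessThan_concat[symmetric]) (auto simp: N_def)
    finally have "poly (\<phi> c) x - poly F (\<pi> * \<eta> c) = (\<Sum>n\<in>{M..<N}. D n c * x ^ (?q ^ n))"
      by (simp add: F(2))
    also have "\<dots> \<in> pi_multiples M"
    proof (intro pi_multiples_sum pi_multiples_mult)
      fix n assume n: "n \<in> {M..<N}"
      show "D n c \<in> R" using R_poly_phi by (simp add: R_poly_def)
      have "n < ?q ^ n" using CARD_ge_2[where 'q = 'q] by (intro power_gt_expt) auto
      then have "M \<le> 2 * ?q ^ n" using n by simp
      moreover have "x ^ (?q ^ n) \<in> pi_multiples (2 * ?q ^ n)"
        unfolding xpow using r(1) by (intro pi_multiplesI R_closed)
      ultimately show "x ^ (?q ^ n) \<in> pi_multiples M" by (rule pi_multiples_mono)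
    qed
    finally show ?thesis .
  qed
  with F(1) show "\<exists>F. R_poly F \<and> (\<forall>c. poly (\<phi> c) x - poly F (\<pi> * \<eta> c) \<in> pi_multiples M)" by blast
qed

end

context adic_ring
begin

text \<open>
  By the pigeonhole principle: \<open>A\<close> is infinite and there are only finitely many classes of points
  modulo \<open>\<pi>\<^sup>2\<close>, so two multiples of \<open>z\<close> agree modulo \<open>\<pi>\<^sup>2\<close>.
\<close>

lemma exists_small_multiple:
  fixes \<phi> :: "'g::finite \<Rightarrow> 'q poly \<Rightarrow> 'k poly"
  assumes \<phi>: "\<And>i. adic_drinfeld_module \<eta> R \<pi> (\<phi> i)" and z: "\<And>i. z i \<in> R"
  shows "\<exists>b. b \<noteq> 0 \<and> (\<forall>i. poly (\<phi> i b) (z i) \<in> pi_multiples 2)"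
proof -
  obtain T where T: "finite T" "\<And>x. x \<in> R \<Longrightarrow> \<exists>t\<in>T. \<exists>r\<in>R. x - t = \<pi> ^ 2 * r"
    using finite_residues by blast
  have "\<exists>t\<in>T. poly (\<phi> i a) (z i) - t \<in> pi_multiples 2" for i a
  proof -
    have "poly (\<phi> i a) (z i) \<in> R"
      using adic_drinfeld_module.R_poly_phi[OF \<phi>] z by (rule R_poly_poly)
    from T(2)[OF this] show ?thesis by (auto simp: pi_multiples_def)
  qed
  then have "\<forall>a. \<exists>t. \<forall>i. t i \<in> T \<and> poly (\<phi> i a) (z i) - t i \<in> pi_multiples 2"
    by (intro allI choice) blast
  then obtain t where t: "\<And>i a. t a i \<in> T" "\<And>i a. poly (\<phi> i a) (z i) - t a i \<in> pi_multiples 2"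
    by (auto dest!: choice)
  have "finite (PiE (UNIV :: 'g set) (\<lambda>_. T))"
    using T(1) by (intro finite_PiE) auto
  then have "finite (range t)"
    by (rule finite_subset[rotated]) (use t(1) in auto)
  moreover have "infinite (UNIV :: 'q poly set)"
    by (rule infinite_UNIV_poly)
  ultimately have "\<not> inj t" using finite_imageD by blast
  then obtain a a' where a: "a \<noteq> a'" "t a = t a'" by (auto simp: inj_def)
  have "poly (\<phi> i (a - a')) (z i) \<in> pi_multiples 2" for i
  proof -
    have "\<phi> i a = \<phi> i (a - a') + \<phi> i a'"
      using adic_drinfeld_module.phi_add[OF \<phi>, of i "a - a'" a'] by simp
    then have "poly (\<phi> i (a - a')) (z i) =
        (poly (\<phi> i a) (z i) - t a i) - (poly (\<phi> i a') (z i) - t a' i)"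
      using a(2) by simp
    then show ?thesis using pi_multiples_diff[OF t(2) t(2)] by simp
  qed
  then show ?thesis using a(1) by (intro exI[of _ "a - a'"]) auto
qed

text \<open>
  Bounded denominators make room for arbitrary constants from \<open>K\<close>, hence for polynomials and for
  translations with coefficients in \<open>K\<close>.
\<close>

definition meromorphic :: "('q poly \<Rightarrow> 'k) \<Rightarrow> bool" where
  "meromorphic \<Phi> \<longleftrightarrow> (\<exists>k. analytic (\<lambda>c. \<pi> ^ k * \<Phi> c))"

lemma analytic_imp_meromorphic: "analytic \<Phi> \<Longrightarrow> meromorphic \<Phi>"
  unfolding meromorphic_def by (intro exI[of _ 0]) simp

lemma meromorphic_const: "meromorphic (\<lambda>c. x)"
  using clear_denominator[of x] analytic_const unfolding meromorphic_def by blast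

lemma meromorphic_mult:
  assumes "meromorphic \<Phi>" "meromorphic \<Psi>"
  shows "meromorphic (\<lambda>c. \<Phi> c * \<Psi> c)"
proof -
  from assms obtain k l where "analytic (\<lambda>c. \<pi> ^ k * \<Phi> c)" "analytic (\<lambda>c. \<pi> ^ l * \<Psi> c)"
    unfolding meromorphic_def by blast
  from analytic_mult[OF this] show ?thesis
    unfolding meromorphic_def by (intro exI[of _ "k + l"]) (simp add: power_add mult_ac)
qed

lemma meromorphic_add:
  assumes "meromorphic \<Phi>" "meromorphic \<Psi>"
  shows "meromorphic (\<lambda>c. \<Phi> c + \<Psi> c)"
proof -
  from assms obtain k l where kl: "analytic (\<lambda>c. \<pi> ^ k * \<Phi> c)" "analytic (\<lambda>c. \<pi> ^ l * \<Psi> c)"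
    unfolding meromorphic_def by blast
  have "analytic (\<lambda>c. \<pi> ^ l * (\<pi> ^ k * \<Phi> c) + \<pi> ^ k * (\<pi> ^ l * \<Psi> c))"
    by (intro analytic_add analytic_mult[OF analytic_const] kl R_closed)
  then show ?thesis
    unfolding meromorphic_def by (intro exI[of _ "k + l"]) (simp add: power_add algebra_simps)
qed

lemma meromorphic_power: "meromorphic \<Phi> \<Longrightarrow> meromorphic (\<lambda>c. \<Phi> c ^ n)"
  by (induction n) (auto intro: meromorphic_const meromorphic_mult)

lemma meromorphic_prod:
  "(\<And>i. i \<in> I \<Longrightarrow> meromorphic (\<Phi> i)) \<Longrightarrow> meromorphic (\<lambda>c. \<Prod>i\<in>I. \<Phi> i c)"
  by (induction I rule: infinite_finite_induct) (auto intro: meromorphic_const meromorphic_mult)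

lemma meromorphic_sum:
  "(\<And>i. i \<in> I \<Longrightarrow> meromorphic (\<Phi> i)) \<Longrightarrow> meromorphic (\<lambda>c. \<Sum>i\<in>I. \<Phi> i c)"
  by (induction I rule: infinite_finite_induct) (auto intro: meromorphic_const meromorphic_add)

lemma meromorphic_identity:
  assumes "meromorphic \<Phi>" "infinite {c. \<Phi> c = 0}"
  shows "\<Phi> c = 0"
proof -
  from assms(1) obtain k where "analytic (\<lambda>c. \<pi> ^ k * \<Phi> c)" unfolding meromorphic_def by blast
  from analytic_identity[OF this, of c] assms(2) pi_nonzero show ?thesis by simp
qed

end

section \<open>Finitely generated modules of rank one\<close>

lemma lookup_free_scale: "Poly_Mapping.lookup (free_scale c f) x = c * Poly_Mapping.lookup f x"
  by (simp add: free_scale_def Poly_Mapping.map.rep_eq when_def)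

text \<open>
  Up to the common denominator \<open>a\<close>, the element \<open>f = \<Sum> f\<^sub>x (x \<otimes> 1)\<close> has coefficients \<open>g x\<close> in the base ring, and
  \<open>\<Sum> g(x) x\<close> vanishes in the module. The set \<open>S\<close> is a finite bound for the support of \<open>g\<close>.
\<close>

definition integral_relation :: "('r::idom \<Rightarrow> 'v::ab_group_add \<Rightarrow> 'v) \<Rightarrow> ('v \<Rightarrow>\<^sub>0 'r fract) \<Rightarrow> bool" where
  "integral_relation scl f \<longleftrightarrow> (\<exists>a g S. a \<noteq> 0 \<and> finite S \<and> (\<forall>x. x \<notin> S \<longrightarrow> g x = 0) \<and>
     (\<forall>x. Fract a 1 * Poly_Mapping.lookup f x = Fract (g x) 1) \<and> (\<Sum>x\<in>S. scl (g x) x) = 0)"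

context Modules.module
begin

lemma sum_scale_delta:
  assumes "finite S" "w \<in> S"
  shows "(\<Sum>z\<in>S. scale (if z = w then c else 0) z) = scale c w"
proof -
  have "(\<Sum>z\<in>S. scale (if z = w then c else 0) z) = (\<Sum>z\<in>S. if z = w then scale c z else 0)"
    by (intro sum.cong) auto
  then show ?thesis using assms by (simp add: sum.delta)
qed

lemma sum_scale_support:
  assumes "finite T" "S \<subseteq> T" "\<And>x. x \<notin> S \<Longrightarrow> g x = 0"
  shows "(\<Sum>x\<in>T. scale (g x) x) = (\<Sum>x\<in>S. scale (g x) x)"
  using assms by (intro sum.mono_neutral_right) auto

end

lemma integral_relation_add:
  fixes scl :: "'r::idom \<Rightarrow> 'v::ab_group_add \<Rightarrow> 'v"
  assumes "Modules.module scl" "integral_relation scl f1" "integral_relation scl f2"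
  shows "integral_relation scl (f1 + f2)"
proof -
  interpret Modules.module scl by fact
  from assms(2) obtain a1 g1 S1 where 1: "a1 \<noteq> 0" "finite S1" "\<And>x. x \<notin> S1 \<Longrightarrow> g1 x = 0"
      "\<And>x. Fract a1 1 * Poly_Mapping.lookup f1 x = Fract (g1 x) 1" "(\<Sum>x\<in>S1. scl (g1 x) x) = 0"
    unfolding integral_relation_def by blast
  from assms(3) obtain a2 g2 S2 where 2: "a2 \<noteq> 0" "finite S2" "\<And>x. x \<notin> S2 \<Longrightarrow> g2 x = 0"
      "\<And>x. Fract a2 1 * Poly_Mapping.lookup f2 x = Fract (g2 x) 1" "(\<Sum>x\<in>S2. scl (g2 x) x) = 0"
    unfolding integral_relation_def by blast
  have "Fract (a1 * a2) 1 * Poly_Mapping.lookup (f1 + f2) x = Fract (a2 * g1 x + a1 * g2 x) 1" for x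
  proof -
    have "Fract (a1 * a2) 1 * Poly_Mapping.lookup (f1 + f2) x =
        Fract a2 1 * (Fract a1 1 * Poly_Mapping.lookup f1 x) + Fract a1 1 * (Fract a2 1 * Poly_Mapping.lookup f2 x)"
      by (simp add: lookup_add distrib_left mult.assoc[symmetric] mult.commute)
    then show ?thesis unfolding 1(4) 2(4) by simp
  qed
  moreover have "(\<Sum>x\<in>S1 \<union> S2. scl (a2 * g1 x + a1 * g2 x) x) = 0"
  proof -
    have "(\<Sum>x\<in>S1 \<union> S2. scl (a2 * g1 x + a1 * g2 x) x) =
        scl a2 (\<Sum>x\<in>S1 \<union> S2. scl (g1 x) x) + scl a1 (\<Sum>x\<in>S1 \<union> S2. scl (g2 x) x)"
      by (simp add: scale_left_distrib sum.distrib scale_sum_right)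
    also have "(\<Sum>x\<in>S1 \<union> S2. scl (g1 x) x) = 0"
      using 1 2(2) sum_scale_support[of "S1 \<union> S2" S1 g1] by simp
    also have "(\<Sum>x\<in>S1 \<union> S2. scl (g2 x) x) = 0"
      using 2 1(2) sum_scale_support[of "S1 \<union> S2" S2 g2] by simp
    finally show ?thesis by simp
  qed
  ultimately show ?thesis unfolding integral_relation_def
    using 1(1-3) 2(1-3)
    by (intro exI[of _ "a1 * a2"] exI[of _ "\<lambda>x. a2 * g1 x + a1 * g2 x"] exI[of _ "S1 \<union> S2"]) auto
qed

lemma integral_relation_scale:
  fixes scl :: "'r::idom \<Rightarrow> 'v::ab_group_add \<Rightarrow> 'v"
  assumes "Modules.module scl" "integral_relation scl f"
  shows "integral_relation scl (free_scale c f)"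
proof -
  interpret Modules.module scl by fact
  from assms(2) obtain a g S where 1: "a \<noteq> 0" "finite S" "\<And>x. x \<notin> S \<Longrightarrow> g x = 0"
      "\<And>x. Fract a 1 * Poly_Mapping.lookup f x = Fract (g x) 1" "(\<Sum>x\<in>S. scl (g x) x) = 0"
    unfolding integral_relation_def by blast
  obtain u w where c: "c = Fract u w" "w \<noteq> 0" by (cases c)
  have "Fract (a * w) 1 * Poly_Mapping.lookup (free_scale c f) x = Fract (u * g x) 1" for x
  proof -
    have "Fract (a * w) 1 * c = Fract u 1 * Fract a 1"
      using c by (simp add: eq_fract mult_ac)
    then have "Fract (a * w) 1 * Poly_Mapping.lookup (free_scale c f) x =
        Fract u 1 * (Fract a 1 * Poly_Mapping.lookup f x)"
      by (simp add: lookup_free_scale mult.assoc[symmetric])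
    then show ?thesis unfolding 1(4) by simp
  qed
  moreover have "(\<Sum>x\<in>S. scl (u * g x) x) = 0"
    using arg_cong[OF 1(5), of "scl u"] by (simp add: scale_sum_right)
  ultimately show ?thesis unfolding integral_relation_def
    using 1 c(2) by (intro exI[of _ "a * w"] exI[of _ "\<lambda>x. u * g x"] exI[of _ S]) auto
qed

lemma tensor_relations_integral:
  fixes scl :: "'r::idom \<Rightarrow> 'v::ab_group_add \<Rightarrow> 'v"
  assumes mod: "Modules.module scl" and f: "f \<in> tensor_relations scl M"
  shows "integral_relation scl f"
proof -
  interpret Modules.module scl by fact
  interpret F: vector_space "free_scale :: 'r fract \<Rightarrow> ('v \<Rightarrow>\<^sub>0 'r fract) \<Rightarrow> _"
    by (rule vector_space_free_scale)
  have "F.subspace {f. integral_relation scl f}"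
  proof (rule F.subspaceI)
    show "0 \<in> {f. integral_relation scl f}"
      unfolding integral_relation_def mem_Collect_eq
      by (rule exI[of _ 1], rule exI[of _ "\<lambda>_. 0"], rule exI[of _ "{}"]) (simp add: Zero_fract_def)
  qed (auto intro: integral_relation_add[OF mod] integral_relation_scale[OF mod])
  moreover have "integral_relation scl
      (Poly_Mapping.single (x + y) 1 - Poly_Mapping.single x 1 - Poly_Mapping.single y 1)" for x y
  proof -
    let ?S = "{x + y, x, y}"
    let ?d = "\<lambda>w z. if z = w then 1 else 0 :: 'r"
    let ?g = "\<lambda>z. ?d (x + y) z - ?d x z - ?d y z"
    have "(\<Sum>z\<in>?S. scl (?g z) z) =
        (\<Sum>z\<in>?S. scl (?d (x + y) z) z) - (\<Sum>z\<in>?S. scl (?d x z) z) - (\<Sum>z\<in>?S. scl (?d y z) z)"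
      by (simp only: scale_left_diff_distrib sum_subtractf)
    also have "\<dots> = 0" by (subst (1 2 3) sum_scale_delta) auto
    finally have s: "(\<Sum>z\<in>?S. scl (?g z) z) = 0" .
    show ?thesis unfolding integral_relation_def
    proof (intro exI conjI allI impI)
      show "(\<Sum>z\<in>?S. scl (?g z) z) = 0" by (rule s)
      show "Fract 1 1 * Poly_Mapping.lookup (Poly_Mapping.single (x + y) 1 - Poly_Mapping.single x 1 -
          Poly_Mapping.single y 1) z = Fract (?g z) 1" for z
      proof -
        have d: "Poly_Mapping.lookup (Poly_Mapping.single w (1 :: 'r fract)) z = Fract (?d w z) 1" for w
          by (auto simp: lookup_single when_def One_fract_def Zero_fract_def)
        show ?thesis unfolding lookup_minus d by simp
      qed
    qed auto
  qed
  moreover have "integral_relation scl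
      (Poly_Mapping.single (scl a x) 1 - free_scale (Fract a 1) (Poly_Mapping.single x 1))" for a x
  proof -
    let ?S = "{scl a x, x}"
    let ?d = "\<lambda>w c z. if z = w then c else 0 :: 'r"
    let ?g = "\<lambda>z. ?d (scl a x) 1 z - ?d x a z"
    have "(\<Sum>z\<in>?S. scl (?g z) z) =
        (\<Sum>z\<in>?S. scl (?d (scl a x) 1 z) z) - (\<Sum>z\<in>?S. scl (?d x a z) z)"
      by (simp only: scale_left_diff_distrib sum_subtractf)
    also have "\<dots> = 0" by (subst (1 2) sum_scale_delta) auto
    finally have s: "(\<Sum>z\<in>?S. scl (?g z) z) = 0" .
    show ?thesis unfolding integral_relation_def
    proof (intro exI conjI allI impI)
      show "(\<Sum>z\<in>?S. scl (?g z) z) = 0" by (rule s)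
      show "Fract 1 1 * Poly_Mapping.lookup (Poly_Mapping.single (scl a x) 1 -
          free_scale (Fract a 1) (Poly_Mapping.single x 1)) z = Fract (?g z) 1" for z
      proof -
        have d: "Fract c 1 * Poly_Mapping.lookup (Poly_Mapping.single w (1 :: 'r fract)) z = Fract (?d w c z) 1" for w c
          by (auto simp: lookup_single when_def One_fract_def Zero_fract_def)
        show ?thesis unfolding lookup_minus lookup_free_scale right_diff_distrib
          using d[of 1 "scl a x"] d[of a x] by (simp add: One_fract_def[symmetric])
      qed
    qed auto
  qed
  ultimately have "F.span ({Poly_Mapping.single (x + y) 1 - Poly_Mapping.single x 1 - Poly_Mapping.single y 1
         | x y. x \<in> M \<and> y \<in> M} \<union>
      {Poly_Mapping.single (scl a x) 1 - free_scale (Fract a 1) (Poly_Mapping.single x 1)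
         | a x. x \<in> M}) \<subseteq> {f. integral_relation scl f}"
    by (intro F.span_minimal) auto
  with f show ?thesis unfolding tensor_relations_def by blast
qed

text \<open>
  The kernel of the map \<open>M \<rightarrow> M \<otimes> F\<close> into the localized module is torsion: a denominator of the relation
  that expresses \<open>z \<otimes> 1 = 0\<close> kills \<open>z\<close>.
\<close>

lemma tensor_eq_0_imp_torsion:
  fixes scl :: "'r::idom \<Rightarrow> 'v::ab_group_add \<Rightarrow> 'v"
  assumes mod: "Modules.module scl" and z: "Poly_Mapping.single z 1 \<in> tensor_relations scl M"
  shows "\<exists>a. a \<noteq> 0 \<and> scl a z = 0"
proof -
  interpret Modules.module scl by fact
  from tensor_relations_integral[OF mod z] obtain a g S where 1: "a \<noteq> 0" "finite S" "\<And>x. x \<notin> S \<Longrightarrow> g x = 0"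
      "\<And>x. Fract a 1 * Poly_Mapping.lookup (Poly_Mapping.single z 1) x = Fract (g x) 1"
      "(\<Sum>x\<in>S. scl (g x) x) = 0"
    unfolding integral_relation_def by blast
  have g: "g x = (if x = z then a else 0)" for x
    using 1(4)[of x] by (auto simp: lookup_single when_def Zero_fract_def eq_fract split: if_splits)
  have "z \<in> S" using 1(1) 1(3)[of z] by (auto simp: g)
  then have "scl a z = 0" using 1(5) sum_scale_delta[OF 1(2)] unfolding g by simp
  with 1(1) show ?thesis by blast
qed

lemma fract_dependent:
  fixes c d :: "'r::idom fract"
  shows "\<exists>a b. (a \<noteq> 0 \<or> b \<noteq> 0) \<and> Fract a 1 * c + Fract b 1 * d = 0"
proof (cases "c = 0")
  case True
  then show ?thesis by (intro exI[of _ 1] exI[of _ 0]) (simp add: Zero_fract_def[symmetric])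
next
  case False
  obtain c1 c2 d1 d2 where cd: "c = Fract c1 c2" "c2 \<noteq> 0" "d = Fract d1 d2" "d2 \<noteq> 0"
    by (metis Fract_cases)
  with False have "c1 \<noteq> 0" by (auto simp: fract_collapse)
  moreover have "Fract (d1 * c2) 1 * c + Fract (- (c1 * d2)) 1 * d = 0"
    using cd by (simp add: Zero_fract_def eq_fract algebra_simps)
  ultimately show ?thesis using cd
    by (intro exI[of _ "d1 * c2"] exI[of _ "- (c1 * d2)"]) auto
qed

text \<open>
  Both \<open>x \<otimes> 1\<close> and \<open>y \<otimes> 1\<close> are multiples of a single vector, so a nontrivial combination \<open>a x + b y\<close>
  vanishes in the tensor product and is therefore torsion.
\<close>

lemma rank_1_dependent:
  fixes scl :: "'r::idom \<Rightarrow> 'v::ab_group_add \<Rightarrow> 'v"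
  assumes mod: "Modules.module scl" and M: "module.subspace scl M" and rank: "has_rank scl M 1"
    and xy: "x \<in> M" "y \<in> M"
  shows "\<exists>a b. (a \<noteq> 0 \<or> b \<noteq> 0) \<and> scl a x + scl b y = 0"
proof -
  interpret Modules.module scl by fact
  interpret F: vector_space "free_scale :: 'r fract \<Rightarrow> ('v \<Rightarrow>\<^sub>0 'r fract) \<Rightarrow> _"
    by (rule vector_space_free_scale)
  let ?E = "tensor_generators M :: ('v \<Rightarrow>\<^sub>0 'r fract) set"
  let ?Rel = "tensor_relations scl M"
  let ?s = "\<lambda>x. Poly_Mapping.single x (1 :: 'r fract)"
  obtain \<beta> where \<beta>: "\<forall>x\<in>?E. \<exists>y\<in>F.span {\<beta>}. x - y \<in> ?Rel"
    using rank unfolding has_rank_def quotient_basis_def by (auto simp: card_1_singleton_iff)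
  have rel: "\<exists>c. ?s x - free_scale c \<beta> \<in> ?Rel" if "x \<in> M" for x
  proof -
    have "?s x \<in> ?E" using that by (simp add: tensor_generators_def)
    from bspec[OF \<beta> this] show ?thesis by (auto simp: F.span_singleton)
  qed
  have sub: "F.subspace ?Rel" unfolding tensor_relations_def by (rule F.subspace_span)
  have R_add: "?s (x + y) - ?s x - ?s y \<in> ?Rel" if "x \<in> M" "y \<in> M" for x y
    unfolding tensor_relations_def using that by (intro F.span_base) blast
  have R_scl: "?s (scl a x) - free_scale (Fract a 1) (?s x) \<in> ?Rel" if "x \<in> M" for a x
    unfolding tensor_relations_def using that by (intro F.span_base) blast
  obtain c d where cd: "?s x - free_scale c \<beta> \<in> ?Rel" "?s y - free_scale d \<beta> \<in> ?Rel"
    using rel xy by blast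
  obtain a b where ab: "a \<noteq> 0 \<or> b \<noteq> 0" "Fract a 1 * c + Fract b 1 * d = 0"
    using fract_dependent by blast
  have M': "scl a x \<in> M" "scl b y \<in> M" using M xy by (auto intro: subspace_scale)
  let ?f = "(?s (scl a x + scl b y) - ?s (scl a x) - ?s (scl b y)) +
      (?s (scl a x) - free_scale (Fract a 1) (?s x)) + (?s (scl b y) - free_scale (Fract b 1) (?s y)) +
      free_scale (Fract a 1) (?s x - free_scale c \<beta>) + free_scale (Fract b 1) (?s y - free_scale d \<beta>)"
  have "?s (scl a x + scl b y) = ?f + free_scale (Fract a 1 * c + Fract b 1 * d) \<beta>"
    by (simp add: F.scale_right_diff_distrib F.scale_left_distrib)
  also have "\<dots> = ?f" by (simp add: ab(2))
  also have "?f \<in> ?Rel"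
    using R_add[OF M'] R_scl xy cd by (intro F.subspace_add[OF sub] F.subspace_scale[OF sub])
  finally obtain e where e: "e \<noteq> 0" "scl e (scl a x + scl b y) = 0"
    using tensor_eq_0_imp_torsion[OF mod] by blast
  then show ?thesis using ab(1)
    by (intro exI[of _ "e * a"] exI[of _ "e * b"]) (auto simp: scale_right_distrib)
qed

text \<open>
  Any element \<open>\<gamma>\<close> that is not torsion has this property. A torsion module is covered by \<open>\<gamma> = 0\<close>.
\<close>

lemma rank_1_generator_up_to_torsion:
  fixes scl :: "'r::idom \<Rightarrow> 'v::ab_group_add \<Rightarrow> 'v"
  assumes mod: "Modules.module scl" and M: "module.subspace scl M" and rank: "has_rank scl M 1"
  shows "\<exists>\<gamma>\<in>M. \<forall>x\<in>M. \<exists>a c. a \<noteq> 0 \<and> scl a x = scl c \<gamma>"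
proof -
  interpret Modules.module scl by fact
  show ?thesis
  proof (cases "\<forall>x\<in>M. \<exists>a. a \<noteq> 0 \<and> scl a x = 0")
    case True
    then have "\<forall>x\<in>M. \<exists>a c. a \<noteq> 0 \<and> scl a x = scl c 0" by simp
    then show ?thesis using subspace_0[OF M] by blast
  next
    case False
    then obtain \<gamma> where \<gamma>: "\<gamma> \<in> M" "\<And>a. a \<noteq> 0 \<Longrightarrow> scl a \<gamma> \<noteq> 0" by blast
    have "\<exists>a c. a \<noteq> 0 \<and> scl a x = scl c \<gamma>" if "x \<in> M" for x
    proof -
      obtain a b where ab: "a \<noteq> 0 \<or> b \<noteq> 0" "scl a x + scl b \<gamma> = 0"
        using rank_1_dependent[OF mod M rank \<open>x \<in> M\<close> \<gamma>(1)] by blast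
      then have "a \<noteq> 0" using \<gamma>(2)[of b] by auto
      moreover have "scl a x = scl (- b) \<gamma>" using ab(2) by (simp add: eq_neg_iff_add_eq_0)
      ultimately show ?thesis by blast
    qed
    with \<gamma>(1) show ?thesis by blast
  qed
qed

text \<open>
  Division with remainder by the annihilators modulo \<open>\<delta>\<close> of the generators shows that linear
  combinations whose coefficients are remainders represent all cosets.
\<close>

lemma finite_index_of_cyclic_submodule:
  fixes scl :: "'a::{field,finite} poly \<Rightarrow> 'v::ab_group_add \<Rightarrow> 'v"
  assumes mod: "Modules.module scl" and F: "finite F"
    and \<delta>: "\<And>x. x \<in> F \<Longrightarrow> \<exists>a c. a \<noteq> 0 \<and> scl a x = scl c \<delta>"
  shows "\<exists>T. finite T \<and> T \<subseteq> module.span scl F \<and>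
    (\<forall>y\<in>module.span scl F. \<exists>x\<in>T. \<exists>c. y = x + scl c \<delta>)"
proof -
  interpret Modules.module scl by fact
  from \<delta> obtain a c where ac: "\<And>x. x \<in> F \<Longrightarrow> a x \<noteq> 0" "\<And>x. x \<in> F \<Longrightarrow> scl (a x) x = scl (c x) \<delta>"
    by metis
  let ?Q = "PiE F (\<lambda>x. {r. Polynomial.degree r < Suc (Polynomial.degree (a x))})"
  define T where "T = (\<lambda>r. \<Sum>x\<in>F. scl (r x) x) ` ?Q"
  have "finite T" unfolding T_def using F finite_poly_degree_less by (intro finite_imageI finite_PiE)
  moreover have "T \<subseteq> span F" unfolding T_def by (auto intro!: span_sum intro: span_scale span_base)
  moreover have "\<exists>x\<in>T. \<exists>e. y = x + scl e \<delta>" if "y \<in> span F" for y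
  proof -
    obtain u where u: "y = (\<Sum>x\<in>F. scl (u x) x)" using \<open>y \<in> span F\<close> F by (auto simp: span_finite)
    let ?r = "restrict (\<lambda>x. u x mod a x) F"
    have "scl (u x) x = scl (?r x) x + scl ((u x div a x) * c x) \<delta>" if "x \<in> F" for x
    proof -
      have "scl (u x) x = scl (u x mod a x + (u x div a x) * a x) x" by simp
      also have "\<dots> = scl (u x mod a x) x + scl (u x div a x) (scl (a x) x)"
        by (simp only: scale_left_distrib scale_scale)
      finally show ?thesis using that ac(2)[OF that] by simp
    qed
    then have "y = (\<Sum>x\<in>F. scl (?r x) x) + scl (\<Sum>x\<in>F. (u x div a x) * c x) \<delta>"
      unfolding u scale_sum_left sum.distrib[symmetric] by (intro sum.cong) auto
    moreover have "?r \<in> ?Q"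
    proof
      fix x assume "x \<in> F"
      then show "?r x \<in> {r. Polynomial.degree r < Suc (Polynomial.degree (a x))}"
        using degree_mod_less[OF ac(1), of x "u x"] by auto
    qed simp
    ultimately show ?thesis unfolding T_def by blast
  qed
  ultimately show ?thesis by blast
qed

section \<open>The Zariski topology\<close>

lemma mpoly_eval_superset:
  assumes "finite S" "Poly_Mapping.keys p \<subseteq> S"
  shows "mpoly_eval p z =
    (\<Sum>m\<in>S. Poly_Mapping.lookup p m * (\<Prod>i\<in>UNIV. (z $ i) ^ Poly_Mapping.lookup m i))"
  unfolding mpoly_eval_def using assms
  by (intro sum.mono_neutral_left) (auto simp: in_keys_iff)

definition polynomial_function :: "('l::field ^ 'g::finite \<Rightarrow> 'l) \<Rightarrow> bool" where
  "polynomial_function f \<longleftrightarrow> (\<exists>p. f = mpoly_eval p)"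

lemma polynomial_function_monomial:
  "polynomial_function (\<lambda>z. c * (\<Prod>i\<in>UNIV. (z $ i) ^ Poly_Mapping.lookup m i))"
  unfolding polynomial_function_def
  by (intro exI[of _ "Poly_Mapping.single m c"] ext, subst mpoly_eval_superset[of "{m}"]) auto

lemma polynomial_function_const: "polynomial_function (\<lambda>z. c)"
  using polynomial_function_monomial[of c 0] by simp

lemma polynomial_function_coordinate:
  "polynomial_function (\<lambda>z :: 'l::field ^ 'g::finite. z $ i)"
proof -
  have "(\<Prod>j\<in>UNIV. (z $ j) ^ Poly_Mapping.lookup (Poly_Mapping.single i 1) j) = z $ i"
    for z :: "'l ^ 'g"
  proof -
    have "(\<Prod>j\<in>UNIV. (z $ j) ^ Poly_Mapping.lookup (Poly_Mapping.single i 1) j) =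
        (\<Prod>j\<in>UNIV. if j = i then z $ j else 1)"
      by (intro prod.cong) (auto simp: lookup_single when_def)
    then show ?thesis by simp
  qed
  moreover have "polynomial_function (\<lambda>z :: 'l ^ 'g. 1 *
      (\<Prod>j\<in>UNIV. (z $ j) ^ Poly_Mapping.lookup (Poly_Mapping.single i 1) j))"
    by (rule polynomial_function_monomial)
  ultimately show ?thesis by simp
qed

lemma polynomial_function_add:
  assumes "polynomial_function f" "polynomial_function g"
  shows "polynomial_function (\<lambda>z. f z + g z)"
proof -
  from assms obtain p r where pr: "f = mpoly_eval p" "g = mpoly_eval r"
    unfolding polynomial_function_def by blast
  let ?S = "Poly_Mapping.keys p \<union> Poly_Mapping.keys r"
  have "mpoly_eval p z + mpoly_eval r z = mpoly_eval (p + r) z" for z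
    using mpoly_eval_superset[of ?S p z] mpoly_eval_superset[of ?S r z]
      mpoly_eval_superset[of ?S "p + r" z] Poly_Mapping.keys_add[of p r]
    by (simp add: lookup_add distrib_right sum.distrib)
  then have "(\<lambda>z. f z + g z) = mpoly_eval (p + r)" unfolding pr by blast
  then show ?thesis unfolding polynomial_function_def by blast
qed

lemma polynomial_function_sum:
  "(\<And>i. i \<in> I \<Longrightarrow> polynomial_function (f i)) \<Longrightarrow> polynomial_function (\<lambda>z. \<Sum>i\<in>I. f i z)"
  by (induction I rule: infinite_finite_induct)
    (auto intro: polynomial_function_const polynomial_function_add)

lemma polynomial_function_mult:
  fixes f g :: "'l::field ^ 'g::finite \<Rightarrow> 'l"
  assumes "polynomial_function f" "polynomial_function g"
  shows "polynomial_function (\<lambda>z. f z * g z)"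
proof -
  from assms obtain p r where pr: "f = mpoly_eval p" "g = mpoly_eval r"
    unfolding polynomial_function_def by blast
  let ?m = "\<lambda>(z :: 'l ^ 'g) m. \<Prod>i\<in>UNIV. (z $ i) ^ Poly_Mapping.lookup m i"
  have "f z * g z = (\<Sum>m\<in>Poly_Mapping.keys p. \<Sum>n\<in>Poly_Mapping.keys r.
      (Poly_Mapping.lookup p m * Poly_Mapping.lookup r n) * ?m z (m + n))" for z
    unfolding pr mpoly_eval_def sum_product
    by (intro sum.cong) (simp_all add: lookup_add power_add prod.distrib mult_ac)
  then show ?thesis
    by (simp only:) (intro polynomial_function_sum polynomial_function_monomial)
qed

lemma polynomial_function_power: "polynomial_function f \<Longrightarrow> polynomial_function (\<lambda>z. f z ^ n)"
  by (induction n) (auto intro: polynomial_function_const polynomial_function_mult)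

lemma polynomial_function_prod:
  "(\<And>i. i \<in> I \<Longrightarrow> polynomial_function (f i)) \<Longrightarrow> polynomial_function (\<lambda>z. \<Prod>i\<in>I. f i z)"
  by (induction I rule: infinite_finite_induct)
    (auto intro: polynomial_function_const polynomial_function_mult)

lemma polynomial_function_poly: "polynomial_function f \<Longrightarrow> polynomial_function (\<lambda>z. poly p (f z))"
  by (induction p)
    (auto intro: polynomial_function_const polynomial_function_add polynomial_function_mult)

text \<open>
  Describing closed sets by polynomial functions in place of formal polynomials makes substitution
  into a polynomial available through the closure properties above.
\<close>

lemma zariski_closed_zero_set:
  assumes "\<And>f. f \<in> Fs \<Longrightarrow> polynomial_function f"
  shows "zariski_closed {z. \<forall>f\<in>Fs. f z = 0}"
proof -
  have "{z. \<forall>f\<in>Fs. f z = 0} = zero_locus {p. mpoly_eval p \<in> Fs}"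
    using assms unfolding zero_locus_def polynomial_function_def by blast
  then show ?thesis unfolding zariski_closed_def by blast
qed

lemma zariski_closed_preimage:
  fixes h :: "'l::field ^ 'g::finite \<Rightarrow> 'l ^ 'g"
  assumes "zariski_closed W" and h: "\<And>i. polynomial_function (\<lambda>z. h z $ i)"
  shows "zariski_closed (h -` W)"
proof -
  obtain P where P: "W = zero_locus P" using assms(1) unfolding zariski_closed_def by blast
  have "polynomial_function (\<lambda>z. mpoly_eval p (h z))" for p
    unfolding mpoly_eval_def
    by (intro polynomial_function_sum polynomial_function_mult polynomial_function_const
        polynomial_function_prod polynomial_function_power h)
  then have "zariski_closed {z. \<forall>f\<in>(\<lambda>p z. mpoly_eval p (h z)) ` P. f z = 0}"
    by (intro zariski_closed_zero_set) auto
  moreover have "h -` W = {z. \<forall>f\<in>(\<lambda>p z. mpoly_eval p (h z)) ` P. f z = 0}"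
    by (auto simp: P zero_locus_def)
  ultimately show ?thesis by simp
qed

lemma zariski_closed_singleton: "zariski_closed {w}"
proof -
  have "polynomial_function (\<lambda>z. z $ i + - (w $ i))" for i
    by (intro polynomial_function_add polynomial_function_coordinate polynomial_function_const)
  then have "zariski_closed {z. \<forall>f\<in>range (\<lambda>i z. z $ i + - (w $ i)). f z = 0}"
    by (intro zariski_closed_zero_set) auto
  moreover have "{z. \<forall>f\<in>range (\<lambda>i z. z $ i + - (w $ i)). f z = 0} = {w}"
    by (auto simp: vec_eq_iff)
  ultimately show ?thesis by simp
qed

lemma irreducible_closed_singleton: "irreducible_closed {w}"
proof -
  have "{w} = V1 \<or> {w} = V2" if "{w} = V1 \<union> V2" for V1 V2
    using that by (metis Un_empty insert_not_empty singleton_Un_iff)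
  then show ?thesis by (simp add: irreducible_closed_def zariski_closed_singleton)
qed

definition zariski_closure :: "('l::field ^ 'g::finite) set \<Rightarrow> ('l ^ 'g) set" where
  "zariski_closure S = zero_locus {p. \<forall>z\<in>S. mpoly_eval p z = 0}"

lemma zariski_closed_closure: "zariski_closed (zariski_closure S)"
  unfolding zariski_closure_def zariski_closed_def by blast

lemma zariski_closure_superset: "S \<subseteq> zariski_closure S"
  unfolding zariski_closure_def zero_locus_def by blast

lemma zariski_closure_minimal: "zariski_closed W \<Longrightarrow> S \<subseteq> W \<Longrightarrow> zariski_closure S \<subseteq> W"
  unfolding zariski_closure_def zariski_closed_def zero_locus_def by blast

text \<open>
  The identity theorem in geometric form: along a rigid family, a closed condition holds for
  finitely many parameters or for all.
\<close>

definition rigid :: "('a \<Rightarrow> 'l::field ^ 'g::finite) \<Rightarrow> bool" where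
  "rigid e \<longleftrightarrow> (\<forall>W. zariski_closed W \<and> infinite {a. e a \<in> W} \<longrightarrow> range e \<subseteq> W)"

text \<open>
  If the closure is a union of two closed sets, one of them contains infinitely many members of the
  family, hence all of them.
\<close>

lemma irreducible_closure_rigid:
  fixes e :: "'a \<Rightarrow> 'l::field ^ 'g::finite"
  assumes inf: "infinite (UNIV :: 'a set)" and e: "rigid e"
  shows "irreducible_closed (zariski_closure (range e))"
  unfolding irreducible_closed_def
proof (intro conjI allI impI)
  show "zariski_closed (zariski_closure (range e))" by (rule zariski_closed_closure)
  show "zariski_closure (range e) \<noteq> {}" using zariski_closure_superset[of "range e"] by auto
  fix V1 V2
  assume V: "zariski_closed V1 \<and> zariski_closed V2 \<and> zariski_closure (range e) = V1 \<union> V2"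
  then have "range e \<subseteq> V1 \<union> V2" using zariski_closure_superset[of "range e"] by simp
  then have "UNIV = {a. e a \<in> V1} \<union> {a. e a \<in> V2}" by blast
  with inf have "infinite {a. e a \<in> V1} \<or> infinite {a. e a \<in> V2}" by (metis finite_Un)
  then have "range e \<subseteq> V1 \<or> range e \<subseteq> V2" using V e unfolding rigid_def by blast
  then show "zariski_closure (range e) = V1 \<or> zariski_closure (range e) = V2"
    using V zariski_closure_minimal by blast
qed

text \<open>
  Otherwise \<open>{w} \<subset> W \<subset> V\<close> for a point \<open>w\<close> of \<open>W\<close> would be a chain of length two.
\<close>

lemma irreducible_curve_eq_infinite_irreducible:
  assumes V: "irreducible_curve V" and W: "irreducible_closed W" "infinite W" "W \<subseteq> V"
  shows "W = V"
proof (rule ccontr)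
  assume "W \<noteq> V"
  obtain w where w: "w \<in> W" using W(2) by fastforce
  have "W \<noteq> {w}" using W(2) by auto
  define Z where "Z = (\<lambda>n::nat. if n = 0 then {w} else if n = 1 then W else V)"
  have "(\<forall>i\<le>2. irreducible_closed (Z i) \<and> Z i \<subseteq> V) \<and> (\<forall>i<2. Z i \<subset> Z (Suc i))"
    using V W w \<open>W \<noteq> {w}\<close> \<open>W \<noteq> V\<close>
    by (auto simp: Z_def irreducible_curve_def irreducible_closed_singleton less_2_cases_iff)
  then have "enat 2 \<le> zariski_dim V"
    unfolding zariski_dim_def by (intro Sup_upper) blast
  with V show False by (simp add: irreducible_curve_def one_enat_def)
qed

section \<open>Orbits of a Drinfeld module\<close>

lemma poly_map_poly_to_ac: "poly (map_poly to_ac f) (to_ac x) = to_ac (poly f x)"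
  by (induction f) (simp_all add: map_poly_pCons)

lemma exists_linear_functional:
  fixes v :: "'k::field alg_closure"
  assumes "v \<noteq> 0"
  shows "\<exists>l :: 'k alg_closure \<Rightarrow> 'k. (\<forall>x y. l (x + y) = l x + l y) \<and>
    (\<forall>c x. l (to_ac c * x) = c * l x) \<and> l v = 1"
proof -
  interpret P: vector_space_pair "\<lambda>c x. to_ac c * x :: 'k alg_closure" "(*) :: 'k \<Rightarrow> 'k \<Rightarrow> 'k"
    by standard (simp_all add: algebra_simps)
  have "P.vs1.independent {v}" using assms by simp
  from P.linear_independent_extend[OF this, of "\<lambda>_. 1"]
  obtain l where l: "Vector_Spaces.linear (\<lambda>c x. to_ac c * x) (*) l" "l v = 1" by auto
  interpret l: Vector_Spaces.linear "\<lambda>c x. to_ac c * x :: 'k alg_closure" "(*) :: 'k \<Rightarrow> 'k \<Rightarrow> 'k" l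
    by (rule l(1))
  show ?thesis using l.add l.scale l(2) by blast
qed

context adic_ring
begin

text \<open>
  Suppose that a polynomial \<open>p\<close> over the algebraic closure vanishes at infinitely many points of the
  orbit, but not at the point with parameter \<open>b\<close>. The points have coordinates in \<open>K\<close>, so applying a \<open>K\<close>-linear
  functional to the value of \<open>p\<close> amounts to applying it to the coefficients, and gives a meromorphic
  function of the parameter. For a functional that does not vanish on the value at \<open>b\<close> this
  contradicts the identity theorem.
\<close>

lemma rigid_orbit:
  fixes \<phi> :: "'g::finite \<Rightarrow> 'q poly \<Rightarrow> 'k poly"
  assumes \<phi>: "\<And>i. adic_drinfeld_module \<eta> R \<pi> (\<phi> i)" and d: "\<And>i. d i \<in> pi_multiples 2"
    and x: "x \<in> rational_points"
  shows "rigid (\<lambda>a. x + phi_action \<phi> a (\<chi> i. to_ac (d i)))"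
  unfolding rigid_def
proof (intro allI impI, elim conjE)
  fix W :: "('k alg_closure ^ 'g) set"
  let ?e = "\<lambda>a. x + phi_action \<phi> a (\<chi> i. to_ac (d i))"
  assume W: "zariski_closed W" and inf: "infinite {a. ?e a \<in> W}"
  obtain P where P: "W = zero_locus P" using W unfolding zariski_closed_def by blast
  have "\<forall>i. \<exists>w. x $ i = to_ac w" using x by (auto simp: rational_points_def)
  then obtain w where w: "\<And>i. x $ i = to_ac (w i)" by metis
  define \<mu> where "\<mu> m a = (\<Prod>i\<in>UNIV. (w i + poly (\<phi> i a) (d i)) ^ Poly_Mapping.lookup m i)" for m a
  have \<mu>: "meromorphic (\<mu> m)" for m
    unfolding \<mu>_def
    by (intro meromorphic_prod meromorphic_power meromorphic_add meromorphic_const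
        analytic_imp_meromorphic adic_drinfeld_module.analytic_phi[OF \<phi> d])
  have expand: "mpoly_eval p (?e a) = (\<Sum>m\<in>Poly_Mapping.keys p. to_ac (\<mu> m a) * Poly_Mapping.lookup p m)" for p a
    by (simp add: mpoly_eval_def phi_action_def w poly_map_poly_to_ac \<mu>_def to_ac_prod mult.commute)
  have "mpoly_eval p (?e b) = 0" if p: "p \<in> P" for p b
  proof (rule ccontr)
    assume "mpoly_eval p (?e b) \<noteq> 0"
    then obtain l :: "'k alg_closure \<Rightarrow> 'k" where l: "\<And>x y. l (x + y) = l x + l y"
        "\<And>c x. l (to_ac c * x) = c * l x" "l (mpoly_eval p (?e b)) = 1"
      using exists_linear_functional by metis
    have l0: "l 0 = 0" using l(2)[of 0 0] by simp
    have l_sum: "l (sum f S) = (\<Sum>i\<in>S. l (f i))" for S and f :: "('g \<Rightarrow>\<^sub>0 nat) \<Rightarrow> 'k alg_closure"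
      by (induction S rule: infinite_finite_induct) (simp_all add: l0 l(1))
    define \<Phi> where "\<Phi> a = (\<Sum>m\<in>Poly_Mapping.keys p. \<mu> m a * l (Poly_Mapping.lookup p m))" for a
    have \<Phi>: "l (mpoly_eval p (?e a)) = \<Phi> a" for a
      by (simp add: expand l_sum l(2) \<Phi>_def)
    have "meromorphic \<Phi>"
      unfolding \<Phi>_def by (intro meromorphic_sum meromorphic_mult meromorphic_const \<mu>)
    moreover have "{a. ?e a \<in> W} \<subseteq> {a. \<Phi> a = 0}"
      using p l0 by (auto simp: P zero_locus_def simp flip: \<Phi>)
    with inf have "infinite {a. \<Phi> a = 0}" using finite_subset by blast
    ultimately have "\<Phi> b = 0" by (rule meromorphic_identity)
    with l(3) \<Phi> show False by simp
  qed
  then show "range ?e \<subseteq> W" by (auto simp: P zero_locus_def)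
qed

end

lemma rational_point_coordinates:
  assumes "x \<in> rational_points"
  obtains w where "x = (\<chi> i. to_ac (w i))"
proof -
  have "\<forall>i. \<exists>w. x $ i = to_ac w" using assms by (auto simp: rational_points_def)
  then obtain w where "\<And>i. x $ i = to_ac (w i)" by metis
  then show thesis using that[of w] by (simp add: vec_eq_iff)
qed

lemma phi_action_rational:
  "phi_action \<phi> a (\<chi> i. to_ac (w i)) = (\<chi> i. to_ac (poly (\<phi> i a) (w i)))"
  by (simp add: phi_action_def poly_map_poly_to_ac)

text \<open>
  Here the prime is chosen: the ring \<open>R\<close> has to contain the coordinates of \<open>\<gamma>\<close> and the coefficients of
  \<open>\<phi>\<^sub>t\<close> and of \<open>\<phi>\<^sub>c\<close> for \<open>c \<in> F_q\<close>. It does not depend on \<open>x\<close> or on the closed sets in question, so that a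
  single \<open>b\<close> works for all of them.
\<close>

lemma exists_rigid_multiple:
  fixes \<iota> :: "'q::finite_field poly fract \<Rightarrow> 'k::field"
    and \<phi> :: "'g::finite \<Rightarrow> 'q poly \<Rightarrow> 'k poly"
  assumes K: "finite_field_extension \<iota>" and drinfeld: "\<And>i. drinfeld_module \<iota> (\<phi> i)"
    and \<gamma>: "\<gamma> \<in> rational_points"
  shows "\<exists>b. b \<noteq> 0 \<and> (\<forall>x\<in>rational_points. rigid (\<lambda>a. x + phi_action \<phi> a (phi_action \<phi> b \<gamma>)))"
proof -
  interpret fraction_field_extension \<iota> using K by unfold_locales
  obtain g where g: "\<gamma> = (\<chi> i. to_ac (g i))" using \<gamma> by (rule rational_point_coordinates)
  define S where "S = range g \<union>
    (\<Union>i. range (Polynomial.coeff (\<phi> i [:0, 1:])) \<union> (\<Union>c. range (Polynomial.coeff (\<phi> i [:c:]))))"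
  have fin: "finite (range (Polynomial.coeff f))" for f :: "'k poly"
  proof (rule finite_subset)
    show "range (Polynomial.coeff f) \<subseteq> insert 0 (Polynomial.coeff f ` {..Polynomial.degree f})"
    proof
      fix c assume "c \<in> range (Polynomial.coeff f)"
      then obtain n where "c = Polynomial.coeff f n" by blast
      then show "c \<in> insert 0 (Polynomial.coeff f ` {..Polynomial.degree f})"
        by (cases "n \<le> Polynomial.degree f") (auto simp: coeff_eq_0)
    qed
  qed simp
  have "finite S" unfolding S_def using fin by auto
  then obtain R \<pi> where R: "adic_ring (\<lambda>a. \<iota> (Fract a 1)) R \<pi>" "S \<subseteq> R"
    using exists_adic_ring by blast
  define \<eta> where "\<eta> a = \<iota> (Fract a 1)" for a
  interpret adic_ring \<eta> R \<pi> using R(1) by (simp add: \<eta>_def[abs_def])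
  have S: "g i \<in> R" "Polynomial.coeff (\<phi> i [:0, 1:]) n \<in> R" "Polynomial.coeff (\<phi> i [:c:]) n \<in> R" for i n c
    using R(2) by (simp_all add: S_def UN_subset_iff image_subset_iff)
  have mod: "adic_drinfeld_module \<eta> R \<pi> (\<phi> i)" for i
  proof
    show "\<phi> i a \<in> carrier (tau_ring CARD('q))" "\<phi> i (a + b) = \<phi> i a + \<phi> i b"
      "\<phi> i (a * b) = pcompose (\<phi> i a) (\<phi> i b)" "Polynomial.coeff (\<phi> i a) 1 = \<eta> a" for a b
      using drinfeld[of i]
      by (auto simp: drinfeld_module_def ring_hom_def ring_of_type_algebra_def tau_ring_def \<eta>_def)
    show "R_poly (\<phi> i [:0, 1:])" "R_poly (\<phi> i [:c:])" for c
      using S by (auto simp: R_poly_def)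
  qed
  obtain b where b: "b \<noteq> 0" "\<And>i. poly (\<phi> i b) (g i) \<in> pi_multiples 2"
    using exists_small_multiple[where \<phi> = \<phi> and z = g, OF mod S(1)] by blast
  have "rigid (\<lambda>a. x + phi_action \<phi> a (phi_action \<phi> b \<gamma>))" if "x \<in> rational_points" for x
    unfolding g phi_action_rational[of \<phi> b] by (rule rigid_orbit[where \<phi> = \<phi> and d = "\<lambda>i. poly (\<phi> i b) (g i)", OF mod b(2) that])
  with b(1) show ?thesis by blast
qed

lemma zariski_closed_translate: "zariski_closed W \<Longrightarrow> zariski_closed ((+) x -` W)"
  by (rule zariski_closed_preimage)
    (auto intro!: polynomial_function_add polynomial_function_const polynomial_function_coordinate)

text \<open>
  Addition and the action are Zariski continuous in each variable. For addition, density is used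
  twice: first with the fixed summand in \<open>S\<close>, then with the fixed summand in the closure.
\<close>

lemma phi_submodule_closure:
  assumes mod: "Modules.module (phi_action \<phi>)" and S: "phi_submodule \<phi> S"
  shows "phi_submodule \<phi> (zariski_closure S)"
proof -
  interpret Modules.module "phi_action \<phi>" by fact
  note S = S[unfolded phi_submodule_def]
  let ?H = "zariski_closure S"
  have translate: "h + z \<in> ?H" if "z \<in> ?H" "S \<subseteq> (+) h -` ?H" for h z
    using zariski_closure_minimal[OF zariski_closed_translate[OF zariski_closed_closure] that(2)] that(1) by auto
  have 1: "s + z \<in> ?H" if "s \<in> S" "z \<in> ?H" for s z
  proof (rule translate[OF that(2)])
    show "S \<subseteq> (+) s -` ?H"
      using subspace_add[OF S that(1)] zariski_closure_superset[of S] by auto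
  qed
  have 2: "h + z \<in> ?H" if "h \<in> ?H" "z \<in> ?H" for h z
  proof (rule translate[OF that(2)])
    show "S \<subseteq> (+) h -` ?H" using 1[OF _ that(1)] by (auto simp: add.commute)
  qed
  have 3: "phi_action \<phi> a z \<in> ?H" if z: "z \<in> ?H" for a z
  proof -
    have "zariski_closed (phi_action \<phi> a -` ?H)"
      using zariski_closed_closure
      by (rule zariski_closed_preimage)
        (simp add: phi_action_def polynomial_function_poly polynomial_function_coordinate)
    moreover have "S \<subseteq> phi_action \<phi> a -` ?H"
      using subspace_scale[OF S] zariski_closure_superset[of S] by auto
    ultimately have "?H \<subseteq> phi_action \<phi> a -` ?H" by (rule zariski_closure_minimal)
    with z show ?thesis by auto
  qed
  show ?thesis
    unfolding phi_submodule_def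
    using 2 3 zariski_closure_superset[of S] subspace_0[OF S] by (intro subspaceI) auto
qed

theorem theorem4p1:
  fixes \<iota> :: "'q::finite_field poly fract \<Rightarrow> 'k::field"
    and \<phi> :: "'g::finite \<Rightarrow> 'q poly \<Rightarrow> 'k poly"
    and V \<Gamma> :: "('k alg_closure ^ 'g) set"
  assumes K: "finite_field_extension \<iota>"
    and drinfeld: "\<And>i. drinfeld_module \<iota> (\<phi> i)"
    and V: "subvariety_over_base V"
    and \<Gamma>: "phi_submodule \<phi> \<Gamma>" "\<Gamma> \<subseteq> rational_points"
      "phi_finitely_generated \<phi> \<Gamma>" "has_rank (phi_action \<phi>) \<Gamma> 1"
  shows "(\<exists>C. finite C \<and>
            (\<forall>S\<in>C. \<exists>x\<in>\<Gamma>. \<exists>H. phi_submodule \<phi> H \<and> H \<subseteq> \<Gamma> \<and> S = (+) x ` H) \<and>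
            V \<inter> rational_points \<inter> \<Gamma> = \<Union>C)
       \<and> (irreducible_curve V \<and>
            \<not> (\<exists>x H. algebraic_phi_submodule \<phi> H \<and> V = (+) x ` H)
          \<longrightarrow> finite (V \<inter> rational_points \<inter> \<Gamma>))"
proof -
  have mod: "Modules.module (phi_action \<phi>)" using K drinfeld by (rule module_phi_action)
  interpret Modules.module "phi_action \<phi>" by (rule mod)
  have sub: "subspace \<Gamma>" using \<Gamma>(1) by (simp add: phi_submodule_def)
  obtain F where F: "finite F" "\<Gamma> = span F" using \<Gamma>(3) unfolding phi_finitely_generated_def by blast
  obtain \<gamma> where \<gamma>: "\<gamma> \<in> \<Gamma>" "\<forall>x\<in>\<Gamma>. \<exists>a c. a \<noteq> 0 \<and> phi_action \<phi> a x = phi_action \<phi> c \<gamma>"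
    using rank_1_generator_up_to_torsion[OF mod sub \<Gamma>(4)] ..
  have "\<gamma> \<in> rational_points" using \<gamma>(1) \<Gamma>(2) by (rule set_mp[rotated])
  from exists_rigid_multiple[where \<phi> = \<phi>, OF K drinfeld this] obtain b where b: "b \<noteq> 0"
      "\<forall>x\<in>rational_points. rigid (\<lambda>a. x + phi_action \<phi> a (phi_action \<phi> b \<gamma>))"
    by (elim exE conjE)
  define \<delta> where "\<delta> = phi_action \<phi> b \<gamma>"
  define e where "e x a = x + phi_action \<phi> a \<delta>" for x a
  define H0 where "H0 = range (\<lambda>a. phi_action \<phi> a \<delta>)"
  have \<delta>: "\<delta> \<in> \<Gamma>" unfolding \<delta>_def using sub \<gamma>(1) by (rule subspace_scale)
  have rigid: "rigid (e x)" if "x \<in> rational_points" for x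
    using bspec[OF b(2) that] by (simp add: e_def[abs_def] \<delta>_def)
  have H0: "phi_submodule \<phi> H0" "H0 \<subseteq> \<Gamma>"
    using subspace_scale[OF sub \<delta>] subspace_span[of "{\<delta>}"]
    by (auto simp: H0_def phi_submodule_def span_singleton)
  have e_range: "range (e x) = (+) x ` H0" for x
    by (auto simp: e_def H0_def)
  have "\<exists>a c. a \<noteq> 0 \<and> phi_action \<phi> a x = phi_action \<phi> c \<delta>" if x: "x \<in> F" for x
  proof -
    have "x \<in> \<Gamma>" using x F(2) by (simp add: span_base)
    then obtain a c where ac: "a \<noteq> 0" "phi_action \<phi> a x = phi_action \<phi> c \<gamma>"
      using \<gamma>(2)[rule_format, of x] by blast
    from arg_cong[OF ac(2), of "phi_action \<phi> b"]
    have "phi_action \<phi> (b * a) x = phi_action \<phi> c \<delta>" by (simp add: \<delta>_def mult.commute)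
    then show ?thesis using ac(1) b(1) by (intro exI[of _ "b * a"] exI[of _ c]) simp
  qed
  then have "\<exists>T. finite T \<and> T \<subseteq> span F \<and> (\<forall>y\<in>span F. \<exists>x\<in>T. \<exists>c. y = x + phi_action \<phi> c \<delta>)"
    by (rule finite_index_of_cyclic_submodule[OF mod F(1)])
  then obtain T where T: "finite T" "T \<subseteq> \<Gamma>" "\<forall>y\<in>\<Gamma>. \<exists>x\<in>T. \<exists>c. y = e x c"
    unfolding F(2)[symmetric] e_def[symmetric] by (elim exE conjE)
  have e_in: "e x a \<in> \<Gamma>" if "x \<in> T" for x a
    unfolding e_def using sub T(2) that \<delta> by (auto intro: subspace_add subspace_scale)
  have closed: "zariski_closed V" using V unfolding subvariety_over_base_def zariski_closed_def by blast
  have VG: "V \<inter> rational_points \<inter> \<Gamma> = V \<inter> \<Gamma>" using \<Gamma>(2) by blast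
  have dichotomy: "finite {a. e x a \<in> V} \<or> range (e x) \<subseteq> V" if "x \<in> T" for x
    using rigid[of x] that T(2) \<Gamma>(2) closed unfolding rigid_def by blast

  have "\<exists>C. finite C \<and>
            (\<forall>S\<in>C. \<exists>x\<in>\<Gamma>. \<exists>H. phi_submodule \<phi> H \<and> H \<subseteq> \<Gamma> \<and> S = (+) x ` H) \<and>
            V \<inter> rational_points \<inter> \<Gamma> = \<Union>C"
  proof -
    \<comment> \<open>cosets inside \<open>V\<close> are taken whole, the others contribute finitely many single points\<close>
    define T1 where "T1 = {x \<in> T. range (e x) \<subseteq> V}"
    define C where "C = (\<lambda>x. range (e x)) ` T1 \<union> (\<Union>x\<in>T - T1. (\<lambda>a. {e x a}) ` {a. e x a \<in> V})"
    have "finite C"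
      unfolding C_def using T(1) dichotomy by (auto simp: T1_def)
    moreover have "\<exists>x\<in>\<Gamma>. \<exists>H. phi_submodule \<phi> H \<and> H \<subseteq> \<Gamma> \<and> S = (+) x ` H" if "S \<in> C" for S
    proof -
      from that consider x where "x \<in> T" "S = range (e x)" | x a where "x \<in> T" "S = {e x a}"
        unfolding C_def T1_def by blast
      then show ?thesis
      proof cases
        case 1
        then show ?thesis using H0 e_range T(2) by blast
      next
        case 2
        have "phi_submodule \<phi> {0}" "{0} \<subseteq> \<Gamma>"
          using subspace_0[OF sub] subspace_single_0 by (auto simp: phi_submodule_def)
        moreover have "S = (+) (e x a) ` {0}" using 2 by simp
        ultimately show ?thesis using e_in[OF 2(1)] by blast
      qed
    qed
    moreover have "V \<inter> rational_points \<inter> \<Gamma> = \<Union>C"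
    proof
      show "V \<inter> rational_points \<inter> \<Gamma> \<subseteq> \<Union>C"
      proof
        fix y assume y: "y \<in> V \<inter> rational_points \<inter> \<Gamma>"
        then obtain x a where "x \<in> T" "y = e x a" using bspec[OF T(3), of y] by blast
        then show "y \<in> \<Union>C" using y by (cases "x \<in> T1") (auto simp: C_def)
      qed
      show "\<Union>C \<subseteq> V \<inter> rational_points \<inter> \<Gamma>"
        unfolding VG using e_in by (auto simp: C_def T1_def)
    qed
    ultimately show ?thesis by blast
  qed
  moreover have "finite (V \<inter> rational_points \<inter> \<Gamma>)"
    if curve: "irreducible_curve V" and no: "\<not> (\<exists>x H. algebraic_phi_submodule \<phi> H \<and> V = (+) x ` H)"
  proof (rule ccontr)
    assume inf: "infinite (V \<inter> rational_points \<inter> \<Gamma>)"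
    have "V \<inter> rational_points \<inter> \<Gamma> \<subseteq> (\<Union>x\<in>T. e x ` {a. e x a \<in> V})"
    proof
      fix y assume y: "y \<in> V \<inter> rational_points \<inter> \<Gamma>"
      then obtain x a where "x \<in> T" "y = e x a" using bspec[OF T(3), of y] by blast
      with y show "y \<in> (\<Union>x\<in>T. e x ` {a. e x a \<in> V})" by blast
    qed
    with inf have "infinite (\<Union>x\<in>T. e x ` {a. e x a \<in> V})" using finite_subset by blast
    with T(1) obtain x where x: "x \<in> T" "infinite (e x ` {a. e x a \<in> V})" by auto
    then have "infinite {a. e x a \<in> V}" using finite_imageI by blast
    with dichotomy[OF x(1)] have sub_V: "range (e x) \<subseteq> V" by blast
    have inf_range: "infinite (range (e x))" using x(2) by (rule infinite_super[rotated]) blast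
    have xr: "x \<in> rational_points" using x(1) T(2) \<Gamma>(2) by blast
    let ?W = "zariski_closure (range (e x))" and ?H = "zariski_closure H0"
    have "?W = V"
    proof (rule irreducible_curve_eq_infinite_irreducible[OF curve])
      show "irreducible_closed ?W"
        using infinite_UNIV_poly rigid[OF xr] by (rule irreducible_closure_rigid)
      show "infinite ?W" using zariski_closure_superset inf_range by (rule infinite_super)
      show "?W \<subseteq> V" using closed sub_V by (rule zariski_closure_minimal)
    qed
    moreover have "?W = (+) x ` ?H"
    proof
      have "H0 \<subseteq> (+) x -` ?W" using zariski_closure_superset[of "range (e x)"] unfolding e_range by auto
      then have "?H \<subseteq> (+) x -` ?W"
        by (intro zariski_closure_minimal zariski_closed_translate zariski_closed_closure)
      then show "(+) x ` ?H \<subseteq> ?W" by auto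
      have "range (e x) \<subseteq> (+) (- x) -` ?H" using zariski_closure_superset[of H0] unfolding e_range by auto
      then have "?W \<subseteq> (+) (- x) -` ?H"
        by (intro zariski_closure_minimal zariski_closed_translate zariski_closed_closure)
      then show "?W \<subseteq> (+) x ` ?H" by (force simp: image_iff)
    qed
    moreover have "algebraic_phi_submodule \<phi> ?H"
    proof -
      \<comment> \<open>the orbit through \<open>0\<close> is rigid as well\<close>
      have "0 \<in> rational_points" by (auto simp: rational_points_def intro: range_eqI[of _ _ 0])
      from irreducible_closure_rigid[OF infinite_UNIV_poly rigid[OF this]]
      have "irreducible_closed ?H" unfolding e_range by simp
      then show ?thesis unfolding algebraic_phi_submodule_def using phi_submodule_closure[OF mod H0(1)] by blast
    qed
    ultimately show False using no by metis
  qed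
  ultimately show ?thesis by blast
qed

end
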